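(* Let the coding system be any one of $\mathsf{K}_1$, $\mathsf{K}_2$, $\mathsf{KV}$. Then $\mathsf{NonDense}$ is complete with respect to $\Sigma^0_2$ subobjects of $\omega^\omega$; that is, $\mathsf{NonDense}$ is a $\Sigma^0_2$ subobject of $\omega^\omega$, and every $\Sigma^0_2$ subobject $A$ of $\omega^\omega$ satisfies $A\leq_{\sf m}\mathsf{NonDense}$.
   Context: Coding systems. $\mathsf{K}_1$: $\mathtt{Code}=\omega$, and the (partial) realizable functions are the partial computable functions on $\omega$. $\mathsf{K}_2$: $\mathtt{Code}=\omega^\omega$, and the realizable functions are the partial continuous functions $x\mapsto p\ast x$ ($p\in\omega^\omega$), where $\ast$ is application in Kleene's second algebra. $\mathsf{KV}$: $\mathtt{Code}=\omega^\omega$ with the same application, and the realizable functions are the partial computable ones (those $x\mapsto p\ast x$ with $p$ computable). Fix one of them; $\langle\cdot,\cdot\rangle$ is a standard computable tupling on $\mathtt{Code}$. A represented space $X$ is a set $|X|$ with a partial surjection $\delta_X$ from $\mathtt{Code}$ onto $|X|$; $p$ is an $X$-name of $x$ if $\delta_X(p)=x$. A morphism $f\colon X\to Y$ is a function $|X|\to|Y|$ for which some partial realizable function sends every $X$-name of $x$ to a $Y$-name of $f(x)$. Names of elements of finite products are tuples of names. In $\mathsf{K}_1$, $n\in\omega$ has name $n$, and $\omega^\omega$ consists of the total computable functions, a name being any index; in $\mathsf{K}_2,\mathsf{KV}$, $n\in\omega$ has name $n0^\infty$, and $\omega^\omega$ consists of all functions, each named by itself. A subobject $A$ of $X$ is a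 represented space with $|A|\subseteq|X|$ such that some partial realizable function sends every $A$-name of $x\in|A|$ to an $X$-name of $x$. It is a subspace if moreover $A$-names and $X$-names of each $x\in|A|$ coincide. For subobjects $A,B$ of $X$, $A\subseteq B$ means $|A|\subseteq|B|$ and the inclusion $A\to B$ is a morphism; $A\equiv B$ means $A\subseteq B$ and $B\subseteq A$. Many-one reducibility: for subobjects $A$ of $X$ and $B$ of $Y$, $A\leq_{\sf m}B$ if there are a morphism $\varphi\colon X\to Y$ and partial realizable functions $r_-,r_+$ with: (1) for all $x\in|X|$, $x\in|A|\iff\varphi(x)\in|B|$; (2) if $p$ is an $A$-name of $x\in|A|$ then $r_-(p)$ is a $B$-name of $\varphi(x)$; (3) if $p$ is an $X$-name of $x\in|A|$ and $q$ is a $B$-name of $\varphi(x)$ then $r_+(p,q)$ is an $A$-name of $x$. A uniformly $\Pi^0_1$ sequence of subobjects of $\omega^\omega$ is a sequence $(B_n)_{n\in\omega}$ for which there is a morphism $f\colon\omega\times\omega^\omega\times\omega\to\omega$ such that $B_n$ is (equivalent, uniformly in $n$, to) the subspace $\{x:\forall k\; f(n,x,k)=0\}$. The witnessed union $\biguplus_nB_n$ has underlying set $\bigcup_n|B_n|$, and $\langle u,p\rangle$ is a name of $x$ in it iff $u$ is a name of some $n\in\omega$ and $p$ is a name of $x\in B_n$. A subobject $A$ of $\omega^\omega$ is $\Sigma^0_2$ if $A\equiv\biguplus_nB_n$ for some uniformly $\Pi^0_1$ sequence $(B_n)$. A linear order on a subset of $\omega$ is coded by the characteristic function in $2^{\omega\times\omega}$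 of its (reflexive) order relation, regarded as an element of $\omega^\omega$ via a standard bijection $\omega\times\omega\cong\omega$; if $x$ codes $\leq_x$, the order is $L_x=\{a\in\omega:a\leq_xa\}$ with $\leq_x$. $\mathsf{NonDense}$ is the subobject of $\omega^\omega$ whose underlying set is the set of $x$ coding a linear order such that not for all $a,b\in L_x$ with $a<_xb$ there is $c\in L_x$ with $a<_xc<_xb$; $\langle a,b,p\rangle$ is a name of $x\in\mathsf{NonDense}$ iff $p$ is an $\omega^\omega$-name of $x$, $a,b\in L_x$, $a<_xb$, and for every $c\in L_x$ either $c\leq_xa$ or $b\leq_xc$. *)

theory Defs
  imports Main "HOL-Library.Nat_Bijection"
begin

section \<open>Partial computable functions on the natural numbers\<close>

text \<open>
  The partial recursive functions, presented as unary functions over the pairing bijection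
  \<^const>\<open>prod_encode\<close>: the basic functions are zero, successor and the two unpairing functions,
  closed under tupling, composition, primitive recursion and minimization.
\<close>

datatype prog =
    Zero | Succ | Left | Right
  | Tuple prog prog | Compose prog prog | PrimRec prog prog | Minim prog

text \<open>\<open>PrimRec c d\<close> sends \<open>\<langle>a, 0\<rangle>\<close> to \<open>c(a)\<close> and \<open>\<langle>a, Suc k\<rangle>\<close> to \<open>d(\<langle>a, \<langle>k, v\<rangle>\<rangle>)\<close>, where \<open>v\<close> is its value
  at \<open>\<langle>a, k\<rangle>\<close>. \<open>Minim c\<close> sends \<open>n\<close> to the least \<open>m\<close> with \<open>c(\<langle>n, m\<rangle>) = 0\<close>, provided that
  \<open>c(\<langle>n, k\<rangle>)\<close> is defined for all \<open>k < m\<close>.\<close>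

primrec eval_prog :: "prog \<Rightarrow> nat \<rightharpoonup> nat" where
  "eval_prog Zero = (\<lambda>n. Some 0)"
| "eval_prog Succ = (\<lambda>n. Some (Suc n))"
| "eval_prog Left = (\<lambda>n. Some (fst (prod_decode n)))"
| "eval_prog Right = (\<lambda>n. Some (snd (prod_decode n)))"
| "eval_prog (Tuple c d) = (\<lambda>n. case (eval_prog c n, eval_prog d n) of
      (Some a, Some b) \<Rightarrow> Some (prod_encode (a, b)) | _ \<Rightarrow> None)"
| "eval_prog (Compose c d) = (\<lambda>n. Option.bind (eval_prog d n) (eval_prog c))"
| "eval_prog (PrimRec c d) = (\<lambda>n. case prod_decode n of (a, m) \<Rightarrow>
      rec_nat (eval_prog c a)
        (\<lambda>k r. Option.bind r (\<lambda>v. eval_prog d (prod_encode (a, prod_encode (k, v))))) m)"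
| "eval_prog (Minim c) = (\<lambda>n.
      if \<exists>m. eval_prog c (prod_encode (n, m)) = Some 0
             \<and> (\<forall>k<m. eval_prog c (prod_encode (n, k)) \<noteq> None)
      then Some (LEAST m. eval_prog c (prod_encode (n, m)) = Some 0)
      else None)"

definition partial_computable :: "(nat \<rightharpoonup> nat) \<Rightarrow> bool" where
  "partial_computable g \<longleftrightarrow> (\<exists>c. g = eval_prog c)"

definition computable :: "(nat \<Rightarrow> nat) \<Rightarrow> bool" where
  "computable f \<longleftrightarrow> partial_computable (\<lambda>n. Some (f n))"

primrec prog_num :: "prog \<Rightarrow> nat" where
  "prog_num Zero = 0"
| "prog_num Succ = 1"
| "prog_num Left = 2"
| "prog_num Right = 3"
| "prog_num (Tuple c d) = 4 + 4 * prod_encode (prog_num c, prog_num d)"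
| "prog_num (Compose c d) = 5 + 4 * prod_encode (prog_num c, prog_num d)"
| "prog_num (PrimRec c d) = 6 + 4 * prod_encode (prog_num c, prog_num d)"
| "prog_num (Minim c) = 7 + 4 * prog_num c"

lemma inj_prog_num: "inj prog_num"
proof (rule injI)
  have neq: "4 + 4 * i \<noteq> 5 + 4 * j" "4 + 4 * i \<noteq> 6 + 4 * j" "4 + 4 * i \<noteq> 7 + 4 * j"
    "5 + 4 * i \<noteq> 6 + 4 * j" "5 + 4 * i \<noteq> 7 + 4 * j" "6 + 4 * i \<noteq> 7 + 4 * j" for i j :: nat
    by presburger+
  fix c d show "prog_num c = prog_num d \<Longrightarrow> c = d"
    by (induction c arbitrary: d; case_tac d; simp add: neq neq[symmetric])
qed

lemma surj_prog_num: "surj prog_num"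
proof -
  have "\<exists>c. prog_num c = n" for n
  proof (induction n rule: less_induct)
    case (less n)
    show ?case
    proof (cases "n < 4")
      case True
      then consider "n = 0" | "n = 1" | "n = 2" | "n = 3" by linarith
      then show ?thesis by cases (metis prog_num.simps(1-4))+
    next
      case False
      define q where "q = (n - 4) div 4"
      obtain a b where ab: "q = prod_encode (a, b)"
        by (metis prod_decode_inverse surj_pair)
      have q: "q < n" using False by (simp add: q_def)
      have "a < n" "b < n"
        using le_prod_encode_1[of a b] le_prod_encode_2[of b a] q ab by auto
      with q less.IH obtain c d e
        where cde: "prog_num c = a" "prog_num d = b" "prog_num e = q" by metis
      have "n = 4 + 4 * q \<or> n = 5 + 4 * q \<or> n = 6 + 4 * q \<or> n = 7 + 4 * q"
        using False unfolding q_def by presburger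
      then show ?thesis
        using cde ab prog_num.simps(5-7)[of c d] prog_num.simps(8)[of e] by metis
    qed
  qed
  then show ?thesis by (metis surjI)
qed

text \<open>Thus \<open>prog_num\<close> is a bijective Goedel numbering, and \<open>\<phi>\<^sub>e\<close> below is the partial computable
  function with index \<open>e\<close>.\<close>

definition phi :: "nat \<Rightarrow> nat \<rightharpoonup> nat" where
  "phi e = eval_prog (inv prog_num e)"

lemma phi_prog_num [simp]: "phi (prog_num c) = eval_prog c"
  by (simp add: phi_def inj_prog_num)

section \<open>Application in Kleene's second algebra\<close>

text \<open>\<open>(p \<^bold>* x)(n) = p(\<langle>n, x(0), \<dots>, x(m-1)\<rangle>) - 1\<close> for the least \<open>m\<close> at which \<open>p\<close> is nonzero;
  \<open>p \<^bold>* x\<close> is defined iff such an \<open>m\<close> exists for every \<open>n\<close>.\<close>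

definition query :: "nat \<Rightarrow> (nat \<Rightarrow> nat) \<Rightarrow> nat \<Rightarrow> nat" where
  "query n x m = list_encode (n # map x [0..<m])"

definition kapp :: "(nat \<Rightarrow> nat) \<Rightarrow> (nat \<Rightarrow> nat) \<rightharpoonup> (nat \<Rightarrow> nat)" where
  "kapp p x =
     (if \<forall>n. \<exists>m. p (query n x m) > 0
      then Some (\<lambda>n. p (query n x (LEAST m. p (query n x m) > 0)) - 1)
      else None)"

section \<open>Represented spaces and coding systems\<close>

text \<open>A represented space with points in \<open>'a\<close> is its representation \<open>\<delta>\<close>, a partial function on codes;
  since \<open>\<delta>\<close> is onto the underlying set, that set is \<open>ran \<delta>\<close>.\<close>

type_synonym ('c, 'a) rep_space = "'c \<rightharpoonup> 'a"

record 'c coding_system =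
  realizable :: "('c \<rightharpoonup> 'c) set"
  tup :: "'c \<times> 'c \<Rightarrow> 'c"
  untup :: "'c \<Rightarrow> 'c \<times> 'c"
  natsp :: "('c, nat) rep_space"
  baire :: "('c, nat \<Rightarrow> nat) rep_space"

definition K1 :: "nat coding_system" where
  "K1 = \<lparr> realizable = {g. partial_computable g},
          tup = prod_encode, untup = prod_decode,
          natsp = (\<lambda>n. Some n),
          baire = (\<lambda>e. if \<forall>n. phi e n \<noteq> None then Some (\<lambda>n. the (phi e n)) else None) \<rparr>"

definition interleave :: "(nat \<Rightarrow> nat) \<times> (nat \<Rightarrow> nat) \<Rightarrow> (nat \<Rightarrow> nat)" where
  "interleave = (\<lambda>(x, y) n. if even n then x (n div 2) else y (n div 2))"

definition uninterleave :: "(nat \<Rightarrow> nat) \<Rightarrow> (nat \<Rightarrow> nat) \<times> (nat \<Rightarrow> nat)" where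
  "uninterleave z = (\<lambda>n. z (2 * n), \<lambda>n. z (2 * n + 1))"

definition nat_name2 :: "(nat \<Rightarrow> nat, nat) rep_space" where
  "nat_name2 x = (if \<forall>k>0. x k = 0 then Some (x 0) else None)"

definition K2 :: "(nat \<Rightarrow> nat) coding_system" where
  "K2 = \<lparr> realizable = {kapp p | p. True},
          tup = interleave, untup = uninterleave,
          natsp = nat_name2, baire = (\<lambda>x. Some x) \<rparr>"

definition KV :: "(nat \<Rightarrow> nat) coding_system" where
  "KV = \<lparr> realizable = {kapp p | p. computable p},
          tup = interleave, untup = uninterleave,
          natsp = nat_name2, baire = (\<lambda>x. Some x) \<rparr>"

lemma untup_tup:
  "untup K1 (tup K1 u) = u" "untup K2 (tup K2 v) = v" "untup KV (tup KV v) = v"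
  by (cases v; simp add: K1_def K2_def KV_def interleave_def uninterleave_def)+

lemma tup_untup:
  "tup K1 (untup K1 n) = n" "tup K2 (untup K2 x) = x" "tup KV (untup KV x) = x"
  by (auto simp: K1_def K2_def KV_def interleave_def uninterleave_def fun_eq_iff)

definition prod_space ::
  "'c coding_system \<Rightarrow> ('c, 'a) rep_space \<Rightarrow> ('c, 'b) rep_space \<Rightarrow> ('c, 'a \<times> 'b) rep_space" where
  "prod_space C X Y z = (case untup C z of (p, q) \<Rightarrow>
     (case (X p, Y q) of (Some x, Some y) \<Rightarrow> Some (x, y) | _ \<Rightarrow> None))"

definition tracks ::
  "('c, 'a) rep_space \<Rightarrow> ('c, 'b) rep_space \<Rightarrow> ('a \<Rightarrow> 'b) \<Rightarrow> ('c \<rightharpoonup> 'c) \<Rightarrow> bool" where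
  "tracks X Y f r \<longleftrightarrow> (\<forall>p x. X p = Some x \<longrightarrow> (\<exists>q. r p = Some q \<and> Y q = Some (f x)))"

text \<open>Only the values of \<open>f\<close> on \<open>ran X\<close> matter; tracking forces them into \<open>ran Y\<close>.\<close>

definition morphism ::
  "'c coding_system \<Rightarrow> ('c, 'a) rep_space \<Rightarrow> ('c, 'b) rep_space \<Rightarrow> ('a \<Rightarrow> 'b) \<Rightarrow> bool" where
  "morphism C X Y f \<longleftrightarrow> (\<exists>r \<in> realizable C. tracks X Y f r)"

definition sub_le ::
  "'c coding_system \<Rightarrow> ('c, 'a) rep_space \<Rightarrow> ('c, 'a) rep_space \<Rightarrow> bool" where
  "sub_le C A B \<longleftrightarrow> ran A \<subseteq> ran B \<and> morphism C A B (\<lambda>x. x)"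

definition sub_equiv ::
  "'c coding_system \<Rightarrow> ('c, 'a) rep_space \<Rightarrow> ('c, 'a) rep_space \<Rightarrow> bool" where
  "sub_equiv C A B \<longleftrightarrow> sub_le C A B \<and> sub_le C B A"

definition subobject ::
  "'c coding_system \<Rightarrow> ('c, 'a) rep_space \<Rightarrow> ('c, 'a) rep_space \<Rightarrow> bool" where
  "subobject C A X \<longleftrightarrow> ran A \<subseteq> ran X
     \<and> (\<exists>r \<in> realizable C. \<forall>p x. A p = Some x \<longrightarrow> (\<exists>q. r p = Some q \<and> X q = Some x))"

definition subspace_of :: "('c, 'a) rep_space \<Rightarrow> 'a set \<Rightarrow> ('c, 'a) rep_space" where
  "subspace_of X S p = (case X p of Some x \<Rightarrow> if x \<in> S then Some x else None | None \<Rightarrow> None)"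

definition many_one_reducible ::
  "'c coding_system \<Rightarrow> ('c, 'a) rep_space \<Rightarrow> ('c, 'a) rep_space
     \<Rightarrow> ('c, 'b) rep_space \<Rightarrow> ('c, 'b) rep_space \<Rightarrow> bool" where
  "many_one_reducible C X A Y B \<longleftrightarrow>
     (\<exists>\<phi> r\<^sub>m r\<^sub>p. morphism C X Y \<phi> \<and> r\<^sub>m \<in> realizable C \<and> r\<^sub>p \<in> realizable C
       \<and> (\<forall>x \<in> ran X. x \<in> ran A \<longleftrightarrow> \<phi> x \<in> ran B)
       \<and> (\<forall>p x. A p = Some x \<longrightarrow> (\<exists>q. r\<^sub>m p = Some q \<and> B q = Some (\<phi> x)))
       \<and> (\<forall>p q x. x \<in> ran A \<and> X p = Some x \<and> B q = Some (\<phi> x)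
            \<longrightarrow> (\<exists>s. r\<^sub>p (tup C (p, q)) = Some s \<and> A s = Some x)))"

section \<open>The class of \<open>\<Sigma>\<^sup>0\<^sub>2\<close> subobjects\<close>

text \<open>Uniform inclusion of sequences: the realizer also receives a name of the index \<open>n\<close>.\<close>

definition uniform_le ::
  "'c coding_system \<Rightarrow> (nat \<Rightarrow> ('c, 'a) rep_space) \<Rightarrow> (nat \<Rightarrow> ('c, 'a) rep_space) \<Rightarrow> bool" where
  "uniform_le C A B \<longleftrightarrow> (\<exists>r \<in> realizable C. \<forall>n u p x.
     natsp C u = Some n \<and> A n p = Some x \<longrightarrow> (\<exists>q. r (tup C (u, p)) = Some q \<and> B n q = Some x))"

definition uniform_equiv ::
  "'c coding_system \<Rightarrow> (nat \<Rightarrow> ('c, 'a) rep_space) \<Rightarrow> (nat \<Rightarrow> ('c, 'a) rep_space) \<Rightarrow> bool" where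
  "uniform_equiv C A B \<longleftrightarrow> uniform_le C A B \<and> uniform_le C B A"

definition uniformly_Pi01 ::
  "'c coding_system \<Rightarrow> (nat \<Rightarrow> ('c, nat \<Rightarrow> nat) rep_space) \<Rightarrow> bool" where
  "uniformly_Pi01 C B \<longleftrightarrow> (\<forall>n. subobject C (B n) (baire C))
     \<and> (\<exists>f. morphism C (prod_space C (natsp C) (prod_space C (baire C) (natsp C))) (natsp C) f
          \<and> uniform_equiv C B (\<lambda>n. subspace_of (baire C) {x. \<forall>k. f (n, x, k) = 0}))"

definition witnessed_union ::
  "'c coding_system \<Rightarrow> (nat \<Rightarrow> ('c, 'a) rep_space) \<Rightarrow> ('c, 'a) rep_space" where
  "witnessed_union C B z = (case untup C z of (u, p) \<Rightarrow>
     (case natsp C u of Some n \<Rightarrow> B n p | None \<Rightarrow> None))"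

definition Sigma02 :: "'c coding_system \<Rightarrow> ('c, nat \<Rightarrow> nat) rep_space \<Rightarrow> bool" where
  "Sigma02 C A \<longleftrightarrow> subobject C A (baire C)
     \<and> (\<exists>B. uniformly_Pi01 C B \<and> sub_equiv C A (witnessed_union C B))"

definition Sigma02_complete :: "'c coding_system \<Rightarrow> ('c, nat \<Rightarrow> nat) rep_space \<Rightarrow> bool" where
  "Sigma02_complete C D \<longleftrightarrow> Sigma02 C D
     \<and> (\<forall>A. Sigma02 C A \<longrightarrow> many_one_reducible C (baire C) A (baire C) D)"

section \<open>Non-dense linear orders\<close>

definition order_rel :: "(nat \<Rightarrow> nat) \<Rightarrow> (nat \<times> nat) set" where
  "order_rel x = {(a, b). x (prod_encode (a, b)) = 1}"

definition order_dom :: "(nat \<Rightarrow> nat) \<Rightarrow> nat set" where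
  "order_dom x = {a. (a, a) \<in> order_rel x}"

definition codes_linear_order :: "(nat \<Rightarrow> nat) \<Rightarrow> bool" where
  "codes_linear_order x \<longleftrightarrow>
     (\<forall>n. x n \<in> {0, 1}) \<and> linear_order_on (order_dom x) (order_rel x)"

definition order_less :: "(nat \<Rightarrow> nat) \<Rightarrow> nat \<Rightarrow> nat \<Rightarrow> bool" where
  "order_less x a b \<longleftrightarrow> (a, b) \<in> order_rel x \<and> a \<noteq> b"

definition dense_order :: "(nat \<Rightarrow> nat) \<Rightarrow> bool" where
  "dense_order x \<longleftrightarrow> (\<forall>a \<in> order_dom x. \<forall>b \<in> order_dom x. order_less x a b \<longrightarrow>
     (\<exists>c \<in> order_dom x. order_less x a c \<and> order_less x c b))"

definition gap :: "(nat \<Rightarrow> nat) \<Rightarrow> nat \<Rightarrow> nat \<Rightarrow> bool" where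
  "gap x a b \<longleftrightarrow> a \<in> order_dom x \<and> b \<in> order_dom x \<and> order_less x a b
     \<and> (\<forall>c \<in> order_dom x. (c, a) \<in> order_rel x \<or> (b, c) \<in> order_rel x)"

text \<open>A name is \<open>\<langle>u, \<langle>v, p\<rangle>\<rangle>\<close> with \<open>u\<close>, \<open>v\<close> names of the endpoints of a gap. The condition
  \<open>\<not> dense_order x\<close> is implied by \<open>gap x a b\<close>; conversely every non-dense order has a name, see
  \<open>ran_NonDense\<close>.\<close>

definition NonDense :: "'c coding_system \<Rightarrow> ('c, nat \<Rightarrow> nat) rep_space" where
  "NonDense C z =
     (case prod_space C (natsp C) (prod_space C (natsp C) (baire C)) z of
        Some (a, b, x) \<Rightarrow>
          if codes_linear_order x \<and> \<not> dense_order x \<and> gap x a b then Some x else None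
      | None \<Rightarrow> None)"

lemma gap_if_not_dense:
  assumes "codes_linear_order x" "\<not> dense_order x"
  shows "\<exists>a b. gap x a b"
proof -
  from assms(2) obtain a b where ab: "a \<in> order_dom x" "b \<in> order_dom x" "order_less x a b"
    and no: "\<And>c. c \<in> order_dom x \<Longrightarrow> \<not> (order_less x a c \<and> order_less x c b)"
    unfolding dense_order_def by blast
  have tot: "total_on (order_dom x) (order_rel x)"
    using assms(1) by (simp add: codes_linear_order_def linear_order_on_def)
  have "(c, a) \<in> order_rel x \<or> (b, c) \<in> order_rel x" if c: "c \<in> order_dom x" for c
  proof (rule ccontr)
    assume n: "\<not> ?thesis"
    then have "c \<noteq> a" "c \<noteq> b" using ab(1,2) by (auto simp: order_dom_def)
    with n have "order_less x a c" "order_less x c b"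
      using tot c ab(1,2) by (auto simp: total_on_def order_less_def)
    with no[OF c] show False by blast
  qed
  with ab show ?thesis unfolding gap_def by blast
qed

lemma ran_NonDense_aux:
  assumes "\<And>u. untup C (tup C u) = u" and "\<And>n. n \<in> ran (natsp C)"
  shows "ran (NonDense C) =
    {x \<in> ran (baire C). codes_linear_order x \<and> \<not> dense_order x}" (is "?L = ?R")
proof
  show "?L \<subseteq> ?R"
    by (auto simp: ran_def NonDense_def prod_space_def
        split: option.split_asm if_split_asm prod.split_asm)
  show "?R \<subseteq> ?L"
  proof
    fix x assume "x \<in> ?R"
    then have nd: "codes_linear_order x" "\<not> dense_order x" and "x \<in> ran (baire C)" by auto
    moreover obtain a b where "gap x a b" using gap_if_not_dense[OF nd] by blast
    ultimately obtain p where p: "baire C p = Some x"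
      and x: "codes_linear_order x" "\<not> dense_order x" "gap x a b"
      unfolding ran_def by blast
    obtain u v where uv: "natsp C u = Some a" "natsp C v = Some b"
      using assms(2) unfolding ran_def by blast
    have "NonDense C (tup C (u, tup C (v, p))) = Some x"
      using p x uv by (simp add: NonDense_def prod_space_def assms(1))
    then show "x \<in> ?L" by (auto simp: ran_def)
  qed
qed

lemma nat_name2_surj: "n \<in> ran nat_name2"
  unfolding ran_def nat_name2_def
  by (rule CollectI, rule exI[of _ "\<lambda>k. if k = 0 then n else 0"]) simp

lemma ran_NonDense:
  "ran (NonDense K1) = {x \<in> ran (baire K1). codes_linear_order x \<and> \<not> dense_order x}"
  "ran (NonDense K2) = {x. codes_linear_order x \<and> \<not> dense_order x}"
  "ran (NonDense KV) = {x. codes_linear_order x \<and> \<not> dense_order x}"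
proof -
  show "ran (NonDense K1) = {x \<in> ran (baire K1). codes_linear_order x \<and> \<not> dense_order x}"
    by (rule ran_NonDense_aux) (simp add: untup_tup, simp add: K1_def ran_def)
  have "ran (baire K2) = UNIV" "ran (baire KV) = UNIV"
    by (auto simp: K2_def KV_def ran_def)
  moreover have "ran (NonDense K2) = {x \<in> ran (baire K2). codes_linear_order x \<and> \<not> dense_order x}"
    by (rule ran_NonDense_aux) (simp add: untup_tup, simp add: K2_def nat_name2_surj)
  moreover have "ran (NonDense KV) = {x \<in> ran (baire KV). codes_linear_order x \<and> \<not> dense_order x}"
    by (rule ran_NonDense_aux) (simp add: untup_tup, simp add: KV_def nat_name2_surj)
  ultimately show "ran (NonDense K2) = {x. codes_linear_order x \<and> \<not> dense_order x}"
    "ran (NonDense KV) = {x. codes_linear_order x \<and> \<not> dense_order x}" by auto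
qed

end

theory Submission
  imports Complex_Main Defs
begin

text \<open>
  A \<open>\<Sigma>\<^sup>0\<^sub>2\<close> subobject is, up to equivalence, of the form \<open>{x. \<exists>n. \<forall>k. f(n, x, k) = 0}\<close>, with names that carry a
  witness \<open>n\<close> (\<open>Sigma02_iff\<close>). \<open>NonDense\<close> has this form because being a linear order with a gap
  between two given points is a universal statement about finitely many values of \<open>x\<close> at a time
  (\<open>gap_test_iff\<close>).

  For hardness, \<open>x\<close> is sent to the sum over \<open>n\<close> of the orders \<open>1 + \<Sum>\<^sub>k \<rat>\<close>, where \<open>k\<close> ranges over the numbers with
  \<open>f(n, x, k) \<noteq> 0\<close>. If there is no such \<open>k\<close>, block \<open>n\<close> is a single point with an immediate successor, the
  first point of block \<open>n + 1\<close> (\<open>block_order_gap\<close>). If there is one, no point of the block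
  has an immediate successor (\<open>gap_block_order\<close>): a nonempty sum of copies of \<open>\<rat>\<close> has neither ends nor gaps.
  Hence witnesses and gaps determine each other, computably in both directions: from a gap only the block of its lower end
  is read off.

  The three coding systems enter only through closure properties of their realizable functions, collected in the locale
  \<open>effective_coding\<close>. For the first Kleene algebra the substantial ones are application of an
  indexed function, which is a universal program, and currying, which is the parametrization theorem. In the second Kleene
  algebra the substantial one is composition; composite associates are given by an explicit formula, computable
  from the given associates, so that continuous and computable associates are treated alike.
\<close>

section \<open>Total computable functions\<close>

abbreviation pfst :: "nat \<Rightarrow> nat" where "pfst n \<equiv> fst (prod_decode n)"
abbreviation psnd :: "nat \<Rightarrow> nat" where "psnd n \<equiv> snd (prod_decode n)"

lemma computable_iff: "computable f \<longleftrightarrow> (\<exists>c. \<forall>n. eval_prog c n = Some (f n))"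
  unfolding computable_def partial_computable_def by (metis ext)

lemma computableI: "(\<And>n. eval_prog c n = Some (f n)) \<Longrightarrow> computable f"
  unfolding computable_iff by blast

text \<open>The rules collected here decompose an expression in one variable \<open>z\<close>. Under a binder the body depends on
  \<open>z\<close> and on the bound variable; such a premise is stated for a single variable \<open>w\<close> that pairs the two,
  so that computability of a whole expression follows by repeated resolution.\<close>

named_theorems computable_intros

lemma computable_id [computable_intros]: "computable (\<lambda>z. z)"
  by (rule computableI[of "Tuple Left Right"]) simp

lemma computable_compose:
  assumes "computable F" "computable f"
  shows "computable (\<lambda>z. F (f z))"
proof -
  from assms obtain c d where "\<And>n. eval_prog c n = Some (F n)" "\<And>n. eval_prog d n = Some (f n)"
    unfolding computable_iff by auto
  then show ?thesis by (intro computableI[of "Compose c d"]) simp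
qed

lemma computable_pair [computable_intros]:
  assumes "computable f" "computable g"
  shows "computable (\<lambda>z. prod_encode (f z, g z))"
proof -
  from assms obtain c d where "\<And>n. eval_prog c n = Some (f n)" "\<And>n. eval_prog d n = Some (g n)"
    unfolding computable_iff by auto
  then show ?thesis by (intro computableI[of "Tuple c d"]) simp
qed

lemma computable_compose2:
  assumes "computable (\<lambda>w. F (pfst w) (psnd w))" "computable f" "computable g"
  shows "computable (\<lambda>z. F (f z) (g z))"
  using computable_compose[OF assms(1) computable_pair[OF assms(2,3)]] by simp

lemma computable_Suc [computable_intros]: "computable f \<Longrightarrow> computable (\<lambda>z. Suc (f z))"
  by (rule computable_compose[of Suc]) (rule computableI[of Succ], simp)

lemma computable_pfst [computable_intros]: "computable f \<Longrightarrow> computable (\<lambda>z. pfst (f z))"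
  by (rule computable_compose[of pfst]) (rule computableI[of Left], simp)

lemma computable_psnd [computable_intros]: "computable f \<Longrightarrow> computable (\<lambda>z. psnd (f z))"
  by (rule computable_compose[of psnd]) (rule computableI[of Right], simp)

lemma computable_const [computable_intros]: "computable (\<lambda>z. k)"
proof (induction k)
  case 0 show ?case by (rule computableI[of Zero]) simp
qed (rule computable_Suc)

lemma computable_rec_nat [computable_intros]:
  assumes "computable c" "computable (\<lambda>w. d (pfst w) (pfst (psnd w)) (psnd (psnd w)))" "computable m"
  shows "computable (\<lambda>z. rec_nat (c z) (\<lambda>k r. d z k r) (m z))"
proof -
  from assms(1,2) obtain p q where p: "\<And>n. eval_prog p n = Some (c n)"
    and q: "\<And>w. eval_prog q w = Some (d (pfst w) (pfst (psnd w)) (psnd (psnd w)))"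
    unfolding computable_iff by auto
  have "eval_prog (PrimRec p q) (prod_encode (z, k)) = Some (rec_nat (c z) (d z) k)" for z k
    by (simp, induction k) (simp_all add: p q)
  then have "computable (\<lambda>w. rec_nat (c (pfst w)) (d (pfst w)) (psnd w))"
    by (intro computableI[of "PrimRec p q"]) (metis prod.collapse prod_decode_inverse)
  then show ?thesis
    by (rule computable_compose2[of "\<lambda>z k. rec_nat (c z) (d z) k", OF _ computable_id assms(3)])
qed

lemma computable_cong: "(\<And>z. f z = g z) \<Longrightarrow> computable f \<Longrightarrow> computable g"
  by presburger

lemma computable_add [computable_intros]:
  assumes "computable f" "computable g" shows "computable (\<lambda>z. f z + g z)"
proof -
  have "rec_nat a (\<lambda>k r. Suc r) b = a + b" for a b :: nat by (induction b) auto
  then show ?thesis by (rule computable_cong) (intro computable_intros assms)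
qed

lemma computable_diff [computable_intros]:
  assumes "computable f" "computable g" shows "computable (\<lambda>z. f z - g z)"
proof -
  have 1: "rec_nat 0 (\<lambda>k r. k) a = a - 1" for a :: nat by (cases a) auto
  have 2: "rec_nat a (\<lambda>k r. rec_nat 0 (\<lambda>k r. k) r) b = a - b" for a b :: nat
    by (induction b) (auto simp: 1)
  show ?thesis by (rule computable_cong, rule 2) (intro computable_intros assms)
qed

lemma computable_mult [computable_intros]:
  assumes "computable f" "computable g" shows "computable (\<lambda>z. f z * g z)"
proof -
  have "rec_nat 0 (\<lambda>k r. r + a) b = a * b" for a b :: nat by (induction b) auto
  then show ?thesis
    by (rule computable_cong) (intro computable_intros assms computable_compose[OF assms(1)])
qed

lemma computable_power [computable_intros]:
  assumes "computable f" "computable g" shows "computable (\<lambda>z. f z ^ g z)"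
proof -
  have "rec_nat 1 (\<lambda>k r. r * a) b = a ^ b" for a b :: nat by (induction b) auto
  then show ?thesis
    by (rule computable_cong) (intro computable_intros assms computable_compose[OF assms(1)])
qed

abbreviation decidable :: "(nat \<Rightarrow> bool) \<Rightarrow> bool" where
  "decidable P \<equiv> computable (\<lambda>z. of_bool (P z))"

lemma decidable_not [computable_intros]: "decidable P \<Longrightarrow> decidable (\<lambda>z. \<not> P z)"
  by (rule computable_cong[of "\<lambda>z. 1 - of_bool (P z)"]) (auto intro!: computable_intros)

lemma decidable_conj [computable_intros]:
  "decidable P \<Longrightarrow> decidable Q \<Longrightarrow> decidable (\<lambda>z. P z \<and> Q z)"
  by (rule computable_cong[of "\<lambda>z. of_bool (P z) * of_bool (Q z)"]) (auto intro!: computable_intros)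

lemma decidable_disj [computable_intros]:
  assumes "decidable P" "decidable Q" shows "decidable (\<lambda>z. P z \<or> Q z)"
proof -
  have "decidable (\<lambda>z. \<not> (\<not> P z \<and> \<not> Q z))" by (intro computable_intros assms)
  then show ?thesis by simp
qed

lemma decidable_imp [computable_intros]:
  assumes "decidable P" "decidable Q" shows "decidable (\<lambda>z. P z \<longrightarrow> Q z)"
  unfolding imp_conv_disj by (intro computable_intros assms)

lemma decidable_le [computable_intros]:
  "computable f \<Longrightarrow> computable g \<Longrightarrow> decidable (\<lambda>z. f z \<le> g z)"
  by (rule computable_cong[of "\<lambda>z. 1 - (f z - g z)"]) (auto intro!: computable_intros)

lemma decidable_less [computable_intros]:
  "computable f \<Longrightarrow> computable g \<Longrightarrow> decidable (\<lambda>z. f z < g z)"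
  unfolding less_eq_Suc_le by (intro computable_intros)

lemma decidable_eq [computable_intros]:
  "computable f \<Longrightarrow> computable g \<Longrightarrow> decidable (\<lambda>z. f z = g z)"
  unfolding order_eq_iff by (intro computable_intros)

lemma computable_if [computable_intros]:
  "decidable P \<Longrightarrow> computable f \<Longrightarrow> computable g \<Longrightarrow> computable (\<lambda>z. if P z then f z else g z)"
  by (rule computable_cong[of "\<lambda>z. of_bool (P z) * f z + (1 - of_bool (P z)) * g z"])
    (auto intro!: computable_intros)

text \<open>Search for a solution below a bound, as a primitive recursion: the accumulator follows the counter
  until it hits a solution, and stays there. Hence the value \<open>n\<close> signals failure below \<open>n\<close>.\<close>

definition search :: "nat \<Rightarrow> (nat \<Rightarrow> bool) \<Rightarrow> nat" where
  "search n P = rec_nat 0 (\<lambda>_ r. if P r then r else Suc r) n"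

lemma search_le: "search n P \<le> n"
  by (induction n) (auto simp: search_def)

lemma search_minimal: "j < search n P \<Longrightarrow> \<not> P j"
  by (induction n) (auto simp: search_def less_Suc_eq split: if_split_asm)

lemma search_solves: "search n P < n \<Longrightarrow> P (search n P)"
proof (induction n)
  case (Suc n)
  show ?case
  proof (cases "search n P < n")
    case True then show ?thesis using Suc by (auto simp: search_def)
  next
    case False
    then have "search n P = n" using search_le[of n P] by simp
    then show ?thesis using Suc.prems by (auto simp: search_def split: if_split_asm)
  qed
qed simp

lemma search_eqI:
  assumes "P j" "\<And>i. i < j \<Longrightarrow> \<not> P i" "j \<le> n"
  shows "search n P = j"
proof (rule antisym)
  show "search n P \<le> j" using search_minimal[of j n P] assms(1) by (meson not_le)
  show "j \<le> search n P" using search_solves[of n P] assms(2,3) by (meson not_le less_le_trans)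
qed

lemma computable_search [computable_intros]:
  assumes "decidable (\<lambda>w. P (pfst w) (psnd w))" "computable n"
  shows "computable (\<lambda>z. search (n z) (\<lambda>k. P z k))"
  unfolding search_def
  by (intro computable_intros assms computable_compose2[where F="\<lambda>z k. of_bool (P z k)", OF assms(1)])

lemma decidable_bex [computable_intros]:
  assumes "decidable (\<lambda>w. P (pfst w) (psnd w))" "computable n"
  shows "decidable (\<lambda>z. \<exists>k<n z. P z k)"
proof -
  have "search (n z) (P z) < n z \<longleftrightarrow> (\<exists>k<n z. P z k)" for z
    by (metis le_neq_implies_less less_irrefl search_le search_minimal search_solves)
  moreover have "decidable (\<lambda>z. search (n z) (P z) < n z)" by (intro computable_intros assms)
  ultimately show ?thesis by simp
qed

lemma decidable_ball [computable_intros]: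
  assumes "decidable (\<lambda>w. P (pfst w) (psnd w))" "computable n"
  shows "decidable (\<lambda>z. \<forall>k<n z. P z k)"
proof -
  have "decidable (\<lambda>z. \<not> (\<exists>k<n z. \<not> P z k))" by (intro computable_intros assms)
  then show ?thesis by simp
qed

lemma computable_div [computable_intros]:
  assumes "computable f" "computable g" shows "computable (\<lambda>z. f z div g z)"
proof -
  have "(if b = 0 then 0 else search a (\<lambda>q. a < Suc q * b)) = a div b" for a b :: nat
  proof (cases "b = 0")
    case False
    have "search a (\<lambda>q. a < Suc q * b) = a div b"
    proof (rule search_eqI)
      show "a < Suc (a div b) * b" using False by (simp add: dividend_less_div_times)
      show "\<not> a < Suc i * b" if "i < a div b" for i
        using that by (metis Suc_leI not_less order_trans mult_le_mono1 div_times_less_eq_dividend)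
    qed simp
    then show ?thesis using False by simp
  qed simp
  then show ?thesis
    by (rule computable_cong)
      (intro computable_intros assms computable_compose[OF assms(1)] computable_compose[OF assms(2)])
qed

lemma computable_mod [computable_intros]:
  assumes "computable f" "computable g" shows "computable (\<lambda>z. f z mod g z)"
  unfolding minus_div_mult_eq_mod[symmetric] by (intro computable_intros assms)

section \<open>A universal partial computable function and parametrization\<close>

abbreviation recorded :: "nat set \<Rightarrow> nat \<Rightarrow> nat \<Rightarrow> nat \<Rightarrow> bool" where
  "recorded W e n v \<equiv> prod_encode (e, prod_encode (n, v)) \<in> W"

text \<open>A set of facts \<open>\<phi>\<^sub>e(n) = v\<close> serves as a certificate for a computation. A fact is justified by \<open>W\<close> if one
  clause of the semantics derives it from facts in \<open>W\<close>; the clauses are read off the residue of \<open>e\<close> modulo 4,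
  which is how the numbering distinguishes the four ways of combining programs.\<close>

definition justified :: "nat set \<Rightarrow> nat \<Rightarrow> nat \<Rightarrow> nat \<Rightarrow> bool" where
  "justified W e n v \<longleftrightarrow>
     (let q = (e - 4) div 4; r = (e - 4) mod 4; c = pfst q; d = psnd q; a = pfst n; m = psnd n in
       e = 0 \<and> v = 0 \<or> e = 1 \<and> v = Suc n \<or> e = 2 \<and> v = a \<or> e = 3 \<and> v = m
     \<or> 4 \<le> e \<and> (
         r = 0 \<and> recorded W c n (pfst v) \<and> recorded W d n (psnd v)
       \<or> r = 1 \<and> (\<exists>y. recorded W d n y \<and> recorded W c y v)
       \<or> r = 2 \<and> m = 0 \<and> recorded W c a v
       \<or> r = 2 \<and> m > 0 \<and> (\<exists>y. recorded W e (prod_encode (a, m - 1)) y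
             \<and> recorded W d (prod_encode (a, prod_encode (m - 1, y))) v)
       \<or> r = 3 \<and> recorded W q (prod_encode (n, v)) 0
           \<and> (\<forall>k<v. \<exists>y. recorded W q (prod_encode (n, k)) (Suc y))))"

lemma Suc_div_mod_4:
  "Suc (4 * q) div 4 = q" "Suc (Suc (4 * q)) div 4 = q" "Suc (Suc (Suc (4 * q))) div 4 = q"
  "Suc (4 * q) mod 4 = 1" "Suc (Suc (4 * q)) mod 4 = 2" "Suc (Suc (Suc (4 * q))) mod 4 = 3"
proof -
  have "(r + 4 * q) div 4 = q \<and> (r + 4 * q) mod 4 = r" if "r < 4" for r :: nat using that by simp
  from this[of "Suc 0"] this[of "Suc (Suc 0)"] this[of "Suc (Suc (Suc 0))"]
  show "Suc (4 * q) div 4 = q" "Suc (Suc (4 * q)) div 4 = q" "Suc (Suc (Suc (4 * q))) div 4 = q"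
    "Suc (4 * q) mod 4 = 1" "Suc (Suc (4 * q)) mod 4 = 2" "Suc (Suc (Suc (4 * q))) mod 4 = 3"
    by (simp_all only: add_Suc add_0)
qed

lemma justified_simps:
  "justified W (prog_num Zero) n v \<longleftrightarrow> v = 0"
  "justified W (prog_num Succ) n v \<longleftrightarrow> v = Suc n"
  "justified W (prog_num Left) n v \<longleftrightarrow> v = pfst n"
  "justified W (prog_num Right) n v \<longleftrightarrow> v = psnd n"
  "justified W (prog_num (Tuple c d)) n v \<longleftrightarrow>
     recorded W (prog_num c) n (pfst v) \<and> recorded W (prog_num d) n (psnd v)"
  "justified W (prog_num (Compose c d)) n v \<longleftrightarrow>
     (\<exists>y. recorded W (prog_num d) n y \<and> recorded W (prog_num c) y v)"
  "justified W (prog_num (PrimRec c d)) (prod_encode (a, 0)) v \<longleftrightarrow> recorded W (prog_num c) a v"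
  "justified W (prog_num (PrimRec c d)) (prod_encode (a, Suc m)) v \<longleftrightarrow>
     (\<exists>y. recorded W (prog_num (PrimRec c d)) (prod_encode (a, m)) y
        \<and> recorded W (prog_num d) (prod_encode (a, prod_encode (m, y))) v)"
  "justified W (prog_num (Minim c)) n v \<longleftrightarrow> recorded W (prog_num c) (prod_encode (n, v)) 0
     \<and> (\<forall>k<v. \<exists>y. recorded W (prog_num c) (prod_encode (n, k)) (Suc y))"
  by (simp_all add: justified_def Let_def Suc_div_mod_4)

definition closed_facts :: "nat set \<Rightarrow> bool" where
  "closed_facts W \<longleftrightarrow> (\<forall>e n v. recorded W e n v \<longrightarrow> justified W e n v)"

lemma closed_factsD: "closed_facts W \<Longrightarrow> recorded W e n v \<Longrightarrow> justified W e n v"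
  by (simp add: closed_facts_def)

text \<open>No order of derivation has to be recorded in \<open>W\<close>: the premises of a justified fact concern proper
  subprograms, except in a primitive recursion, where they concern the same program at a smaller
  recursion argument. So induction on the program, with an inner induction for \<^const>\<open>PrimRec\<close>, suffices.\<close>

lemma closed_facts_sound:
  assumes W: "closed_facts W"
  shows "recorded W (prog_num c) n v \<Longrightarrow> eval_prog c n = Some v"
proof (induction c arbitrary: n v)
  case (Tuple c d)
  with closed_factsD[OF W Tuple.prems] show ?case unfolding justified_simps by fastforce
next
  case (Compose c d)
  with closed_factsD[OF W Compose.prems] show ?case unfolding justified_simps by fastforce
next
  case (PrimRec c d)
  obtain a m where n: "n = prod_encode (a, m)" by (metis prod_decode_inverse surj_pair)
  have "eval_prog (PrimRec c d) (prod_encode (a, m)) = Some v"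
    if "recorded W (prog_num (PrimRec c d)) (prod_encode (a, m)) v" for m v
    using that
  proof (induction m arbitrary: v)
    case 0
    then show ?case using closed_factsD[OF W 0] PrimRec.IH(1) unfolding justified_simps by simp
  next
    case (Suc m)
    from closed_factsD[OF W Suc.prems] obtain y
      where y: "recorded W (prog_num (PrimRec c d)) (prod_encode (a, m)) y"
        "recorded W (prog_num d) (prod_encode (a, prod_encode (m, y))) v"
      unfolding justified_simps by blast
    show ?case using Suc.IH[OF y(1)] PrimRec.IH(2)[OF y(2)] by simp
  qed
  with PrimRec.prems n show ?case by blast
next
  case (Minim c)
  from closed_factsD[OF W Minim.prems] Minim.IH
  have zero: "eval_prog c (prod_encode (n, v)) = Some 0"
    and pos: "\<And>k. k < v \<Longrightarrow> \<exists>y. eval_prog c (prod_encode (n, k)) = Some (Suc y)"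
    unfolding justified_simps by blast+
  have "(LEAST m. eval_prog c (prod_encode (n, m)) = Some 0) = v"
    using zero pos by (intro Least_equality) (fastforce intro!: leI)+
  moreover have "\<exists>m. eval_prog c (prod_encode (n, m)) = Some 0
      \<and> (\<forall>k<m. eval_prog c (prod_encode (n, k)) \<noteq> None)"
    using zero pos by (intro exI[of _ v]) fastforce
  ultimately show ?case by simp
qed (use closed_factsD[OF W] in \<open>fastforce simp del: prog_num.simps simp: justified_simps\<close>)+

lemma justified_mono: "W \<subseteq> W' \<Longrightarrow> justified W e n v \<Longrightarrow> justified W' e n v"
  unfolding justified_def Let_def by (elim disjE conjE) (simp_all, blast+)

lemma closed_facts_UN: "(\<And>k. k \<in> K \<Longrightarrow> closed_facts (W k)) \<Longrightarrow> closed_facts (\<Union>k\<in>K. W k)"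
  unfolding closed_facts_def by (meson UN_E UN_upper justified_mono)

lemma closed_facts_Un: "closed_facts V \<Longrightarrow> closed_facts W \<Longrightarrow> closed_facts (V \<union> W)"
  unfolding closed_facts_def by (meson Un_iff Un_upper1 Un_upper2 justified_mono)

lemma closed_facts_insert:
  assumes "closed_facts W" "justified W e n v"
  shows "closed_facts (insert (prod_encode (e, prod_encode (n, v))) W)"
  using assms justified_mono[OF subset_insertI] unfolding closed_facts_def by (auto simp: prod_encode_eq)

definition certified :: "nat \<Rightarrow> nat \<Rightarrow> nat \<Rightarrow> bool" where
  "certified e n v \<longleftrightarrow> (\<exists>W. finite W \<and> closed_facts W \<and> recorded W e n v)"

lemma certifiedI: "finite W \<Longrightarrow> closed_facts W \<Longrightarrow> justified W e n v \<Longrightarrow> certified e n v"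
  unfolding certified_def by (meson closed_facts_insert finite_insert insertI1)

lemma certified_pairE:
  assumes "certified e n v" "certified e' n' v'"
  obtains W where "finite W" "closed_facts W" "recorded W e n v" "recorded W e' n' v'"
  using assms closed_facts_Un unfolding certified_def by (meson UnI1 UnI2 finite_UnI)

text \<open>A terminating evaluation uses only finitely many facts. The unbounded search \<open>Minim c\<close> uses one for each
  value \<open>k\<close> tried, and the union of their certificates is again finite and closed.\<close>

lemma certified_complete: "eval_prog c n = Some v \<Longrightarrow> certified (prog_num c) n v"
proof (induction c arbitrary: n v)
  case (Tuple c d)
  then obtain a b where "eval_prog c n = Some a" "eval_prog d n = Some b" "v = prod_encode (a, b)"
    by (auto split: option.splits)
  with Tuple.IH show ?case
    by (metis certified_pairE certifiedI justified_simps(5) prod_encode_inverse fst_conv snd_conv)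
next
  case (Compose c d)
  then obtain y where "eval_prog d n = Some y" "eval_prog c y = Some v"
    by (auto simp: bind_eq_Some_conv)
  with Compose.IH show ?case by (metis certified_pairE certifiedI justified_simps(6))
next
  case (PrimRec c d)
  obtain a m where n: "n = prod_encode (a, m)" by (metis prod_decode_inverse surj_pair)
  have "certified (prog_num (PrimRec c d)) (prod_encode (a, m)) v"
    if "eval_prog (PrimRec c d) (prod_encode (a, m)) = Some v" for m v
    using that
  proof (induction m arbitrary: v)
    case 0
    then have "certified (prog_num c) a v" using PrimRec.IH(1) by simp
    then show ?case unfolding certified_def[of "prog_num c"] by (metis certifiedI justified_simps(7))
  next
    case (Suc m)
    then obtain y where y: "eval_prog (PrimRec c d) (prod_encode (a, m)) = Some y"
      "eval_prog d (prod_encode (a, prod_encode (m, y))) = Some v"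
      by (auto simp: bind_eq_Some_conv)
    show ?case
      by (rule certified_pairE[OF Suc.IH[OF y(1)] PrimRec.IH(2)[OF y(2)]])
        (metis certifiedI justified_simps(8))
  qed
  with PrimRec.prems n show ?case by blast
next
  case (Minim c)
  let ?P = "\<lambda>m. eval_prog c (prod_encode (n, m)) = Some 0"
  from Minim.prems have v: "v = (LEAST m. ?P m)"
    and "\<exists>m. ?P m \<and> (\<forall>k<m. eval_prog c (prod_encode (n, k)) \<noteq> None)"
    by (auto split: if_splits)
  then obtain m where m: "?P m" "\<And>k. k < m \<Longrightarrow> eval_prog c (prod_encode (n, k)) \<noteq> None" by blast
  have zero: "?P v" unfolding v by (rule LeastI[of ?P, OF m(1)])
  have "v \<le> m" unfolding v by (rule Least_le[of ?P, OF m(1)])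
  have "\<exists>y. eval_prog c (prod_encode (n, k)) = Some (Suc y)" if "k < v" for k
    using that m(2)[of k] \<open>v \<le> m\<close> not_less_Least[of k ?P] v by (metis less_le_trans not0_implies_Suc not_None_eq)
  then have "\<exists>W y. finite W \<and> closed_facts W \<and> recorded W (prog_num c) (prod_encode (n, k)) (Suc y)"
    if "k < v" for k using that Minim.IH unfolding certified_def by meson
  then obtain W y where W: "\<And>k. k < v \<Longrightarrow> finite (W k)" "\<And>k. k < v \<Longrightarrow> closed_facts (W k)"
    "\<And>k. k < v \<Longrightarrow> recorded (W k) (prog_num c) (prod_encode (n, k)) (Suc (y k))" by metis
  obtain V where V: "finite V" "closed_facts V" "recorded V (prog_num c) (prod_encode (n, v)) 0"
    using Minim.IH[OF zero] unfolding certified_def by blast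
  let ?U = "V \<union> (\<Union>k\<in>{..<v}. W k)"
  have "closed_facts ?U" by (intro closed_facts_Un closed_facts_UN V W) simp
  moreover have "finite ?U" using V W by simp
  moreover have "justified ?U (prog_num (Minim c)) n v" unfolding justified_simps using V W by blast
  ultimately show ?case by (metis certifiedI)
qed (auto intro!: certifiedI[of "{}"] simp: justified_simps[simplified] closed_facts_def)

text \<open>Finite sets are coded by sums of powers of two, which exceed each exponent and hence all numbers coded in
  it. This bounds every quantifier in the notion of a closed set of facts, which makes that notion decidable.\<close>

lemma recorded_bound: assumes "recorded (set_decode w) e n v" shows "v < w"
proof -
  let ?t = "prod_encode (e, prod_encode (n, v))"
  have "v \<le> ?t" by (meson le_prod_encode_2 order_trans)
  also have "?t < 2 ^ ?t" by simp
  also have "\<dots> \<le> w" using assms by (auto simp: set_decode_def intro!: leI)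
  finally show ?thesis .
qed

lemma decidable_set_decode [computable_intros]:
  assumes "computable f" "computable g" shows "decidable (\<lambda>z. f z \<in> set_decode (g z))"
  unfolding set_decode_def mem_Collect_eq odd_iff_mod_2_eq_one by (intro computable_intros assms)

lemma justified_bounded:
  "justified (set_decode w) e n v \<longleftrightarrow>
     (let q = (e - 4) div 4; r = (e - 4) mod 4; c = pfst q; d = psnd q; a = pfst n; m = psnd n;
          W = set_decode w in
       e = 0 \<and> v = 0 \<or> e = 1 \<and> v = Suc n \<or> e = 2 \<and> v = a \<or> e = 3 \<and> v = m
     \<or> 4 \<le> e \<and> (
         r = 0 \<and> recorded W c n (pfst v) \<and> recorded W d n (psnd v)
       \<or> r = 1 \<and> (\<exists>y<w. recorded W d n y \<and> recorded W c y v)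
       \<or> r = 2 \<and> m = 0 \<and> recorded W c a v
       \<or> r = 2 \<and> m > 0 \<and> (\<exists>y<w. recorded W e (prod_encode (a, m - 1)) y
             \<and> recorded W d (prod_encode (a, prod_encode (m - 1, y))) v)
       \<or> r = 3 \<and> recorded W q (prod_encode (n, v)) 0
           \<and> (\<forall>k<v. \<exists>y<w. recorded W q (prod_encode (n, k)) (Suc y))))"
proof -
  have b: "(\<exists>y. recorded (set_decode w) e n y \<and> Q y) \<longleftrightarrow> (\<exists>y<w. recorded (set_decode w) e n y \<and> Q y)"
    for e n Q using recorded_bound by blast
  have b': "(\<exists>y. recorded (set_decode w) e n (Suc y)) \<longleftrightarrow> (\<exists>y<w. recorded (set_decode w) e n (Suc y))"
    for e n using recorded_bound Suc_lessD by blast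
  show ?thesis unfolding justified_def Let_def b b' ..
qed

lemma closed_facts_bounded:
  "closed_facts (set_decode w) \<longleftrightarrow>
     (\<forall>t<w. t \<in> set_decode w \<longrightarrow> justified (set_decode w) (pfst t) (pfst (psnd t)) (psnd (psnd t)))"
proof -
  have "t < w" if "t \<in> set_decode w" for t
  proof -
    have "t < 2 ^ t" by simp
    also have "\<dots> \<le> w" using that by (auto simp: set_decode_def intro!: leI)
    finally show ?thesis .
  qed
  then show ?thesis unfolding closed_facts_def
    by (metis prod.collapse prod_decode_inverse prod_encode_inverse fst_conv snd_conv)
qed

lemma decidable_closed_facts [computable_intros]:
  assumes "computable f" shows "decidable (\<lambda>z. closed_facts (set_decode (f z)))"
  by (rule computable_compose[OF _ assms])
    (unfold closed_facts_bounded justified_bounded Let_def, intro computable_intros)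

text \<open>The universal program searches for the least code of a closed set of facts that contains a fact about
  \<open>\<phi>\<^sub>e(n)\<close>, and reads off the value. By soundness every such set gives the right value.\<close>

theorem universal_program:
  obtains u where "\<And>e n v. phi e n = Some v \<Longrightarrow> eval_prog u (prod_encode (e, n)) = Some v"
proof -
  define T where "T z w \<longleftrightarrow> closed_facts (set_decode w)
    \<and> (\<exists>v<w. recorded (set_decode w) (pfst z) (psnd z) v)" for z w
  define V where "V z w = search w (\<lambda>v. recorded (set_decode w) (pfst z) (psnd z) v)" for z w
  have "decidable (\<lambda>y. \<not> T (pfst y) (psnd y))" unfolding T_def by (intro computable_intros)
  then obtain t where t: "\<And>y. eval_prog t y = Some (of_bool (\<not> T (pfst y) (psnd y)))"
    unfolding computable_iff by blast
  have "computable (\<lambda>y. V (pfst y) (psnd y))" unfolding V_def by (intro computable_intros)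
  then obtain r where r: "\<And>y. eval_prog r y = Some (V (pfst y) (psnd y))"
    unfolding computable_iff by blast
  let ?u = "Compose r (Tuple (Tuple Left Right) (Minim t))"
  have "eval_prog ?u (prod_encode (e, n)) = Some v" if phi: "phi e n = Some v" for e n v
  proof -
    obtain c where c: "e = prog_num c" by (metis surj_prog_num surjD)
    with phi have ev: "eval_prog c n = Some v" by simp
    let ?z = "prod_encode (e, n)"
    obtain W where W: "finite W" "closed_facts W" "recorded W e n v"
      using certified_complete[OF ev] c unfolding certified_def by blast
    let ?w = "set_encode W"
    have "set_decode ?w = W" using W(1) by simp
    then have "T ?z ?w" unfolding T_def using W recorded_bound[of e n v ?w] by auto
    then have ex: "\<exists>w. T ?z w" by blast
    define w where "w = (LEAST w. T ?z w)"
    have w: "T ?z w" unfolding w_def using ex by (rule LeastI_ex)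
    have "eval_prog (Minim t) ?z = Some w" using ex by (simp add: t w_def)
    moreover have "V ?z w = v"
    proof -
      have uniq: "v' = v" if "recorded (set_decode w) e n v'" for v'
        using closed_facts_sound[of "set_decode w" c n v'] that w ev c by (simp add: T_def)
      from w obtain v' where "recorded (set_decode w) e n v'" unfolding T_def by auto
      then have v: "recorded (set_decode w) e n v" using uniq by blast
      show ?thesis unfolding V_def prod_encode_inverse fst_conv snd_conv
      proof (rule search_eqI)
        show "recorded (set_decode w) e n v" by (rule v)
        show "\<not> recorded (set_decode w) e n i" if "i < v" for i using uniq that by blast
        show "v \<le> w" using recorded_bound[OF v] by simp
      qed
    qed
    ultimately show ?thesis by (simp add: r)
  qed
  then show ?thesis by (rule that)
qed

primrec const_prog :: "nat \<Rightarrow> prog" where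
  "const_prog 0 = Zero"
| "const_prog (Suc k) = Compose Succ (const_prog k)"

lemma eval_const_prog [simp]: "eval_prog (const_prog k) n = Some k"
  by (induction k) auto

lemma computable_prog_num_const: "computable (\<lambda>k. prog_num (const_prog k))"
proof -
  have "rec_nat 0 (\<lambda>_ r. 5 + 4 * prod_encode (1, r)) k = prog_num (const_prog k)" for k
    by (induction k) auto
  then show ?thesis by (rule computable_cong) (intro computable_intros)
qed

text \<open>The program for \<open>n \<mapsto> \<phi>\<^sub>c(\<langle>p, n\<rangle>)\<close> has \<open>p\<close> built in as a constant; its number is a computable function
  of \<open>p\<close> because constants are iterated successors.\<close>

theorem parametrization:
  obtains s where "computable s" "\<And>p n. phi (s p) n = eval_prog c (prod_encode (p, n))"
proof
  let ?s = "\<lambda>p. prog_num (Compose c (Tuple (const_prog p) (Tuple Left Right)))"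
  show "computable ?s" unfolding prog_num.simps(5,6)
    by (intro computable_intros computable_prog_num_const)
  show "phi (?s p) n = eval_prog c (prod_encode (p, n))" for p n
    by (simp del: prog_num.simps)
qed

section \<open>Effective coding systems\<close>

lemma prod_space_eq_Some:
  "prod_space C X Y z = Some (x, y) \<longleftrightarrow> X (fst (untup C z)) = Some x \<and> Y (snd (untup C z)) = Some y"
  by (auto simp: prod_space_def split: prod.splits option.splits)

lemma witnessed_union_eq_Some:
  "witnessed_union C B z = Some x \<longleftrightarrow>
     (\<exists>n. natsp C (fst (untup C z)) = Some n \<and> B n (snd (untup C z)) = Some x)"
  by (auto simp: witnessed_union_def split: prod.splits option.splits)

lemma subspace_of_eq_Some: "subspace_of X S p = Some x \<longleftrightarrow> X p = Some x \<and> x \<in> S"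
  by (auto simp: subspace_of_def split: option.splits)

lemma sub_leI:
  assumes "r \<in> realizable C" "\<And>p x. A p = Some x \<Longrightarrow> \<exists>q. r p = Some q \<and> B q = Some x"
  shows "sub_le C A B"
  using assms unfolding sub_le_def morphism_def tracks_def ran_def by blast

lemma sub_leE:
  assumes "sub_le C A B"
  obtains r where "r \<in> realizable C" "\<And>p x. A p = Some x \<Longrightarrow> \<exists>q. r p = Some q \<and> B q = Some x"
  using assms unfolding sub_le_def morphism_def tracks_def by blast

lemma morphismE:
  assumes "morphism C X Y f"
  obtains r where "r \<in> realizable C" "\<And>p x. X p = Some x \<Longrightarrow> \<exists>q. r p = Some q \<and> Y q = Some (f x)"
  using assms unfolding morphism_def tracks_def by blast

lemma morphismI:
  assumes "r \<in> realizable C" "\<And>p x. X p = Some x \<Longrightarrow> \<exists>q. r p = Some q \<and> Y q = Some (f x)"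
  shows "morphism C X Y f"
  using assms unfolding morphism_def tracks_def by blast

text \<open>The closure properties of the realizable functions on which the argument rests: a cartesian structure,
  computable functions on \<open>\<omega>\<close>, and \<open>\<omega>\<^sup>\<omega>\<close> as an object of functions from \<open>\<omega>\<close> to \<open>\<omega>\<close>, with application
  and currying. Each closure property asks only for a realizable function that extends the expected one on
  the relevant names, since the natural realizers in Kleene's second algebra may be defined on more names.\<close>

locale effective_coding =
  fixes C :: "'c coding_system"
  assumes untup_tup: "\<And>u. untup C (tup C u) = u"
    and tup_untup: "\<And>z. tup C (untup C z) = z"
    and realizable_comp: "\<And>f g. f \<in> realizable C \<Longrightarrow> g \<in> realizable C \<Longrightarrow>
      \<exists>h \<in> realizable C. \<forall>p q s. f p = Some q \<and> g q = Some s \<longrightarrow> h p = Some s"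
    and realizable_pair: "\<And>f g. f \<in> realizable C \<Longrightarrow> g \<in> realizable C \<Longrightarrow>
      \<exists>h \<in> realizable C. \<forall>p q s. f p = Some q \<and> g p = Some s \<longrightarrow> h p = Some (tup C (q, s))"
    and realizable_id: "\<exists>h \<in> realizable C. \<forall>p. h p = Some p"
    and realizable_fst: "\<exists>h \<in> realizable C. \<forall>p. h p = Some (fst (untup C p))"
    and realizable_snd: "\<exists>h \<in> realizable C. \<forall>p. h p = Some (snd (untup C p))"
    and morphism_computable: "\<And>g. computable g \<Longrightarrow> morphism C (natsp C) (natsp C) g"
    and morphism_prod_encode: "morphism C (prod_space C (natsp C) (natsp C)) (natsp C) prod_encode"
    and morphism_apply: "morphism C (prod_space C (baire C) (natsp C)) (natsp C) (\<lambda>(x, n). x n)"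
    and realizable_curry: "\<And>r. r \<in> realizable C \<Longrightarrow>
      \<exists>h \<in> realizable C. \<forall>p g.
        (\<forall>u n. natsp C u = Some n \<longrightarrow> (\<exists>v. r (tup C (p, u)) = Some v \<and> natsp C v = Some (g n)))
        \<longrightarrow> (\<exists>q. h p = Some q \<and> baire C q = Some g)"
begin

lemma morphism_id: "morphism C X X (\<lambda>x. x)"
  using realizable_id morphismI[where C=C] by (metis (no_types, lifting))

lemma morphism_comp:
  assumes "morphism C Y Z g" "morphism C X Y f"
  shows "morphism C X Z (\<lambda>x. g (f x))"
proof -
  obtain r s where r: "r \<in> realizable C" "\<And>p x. X p = Some x \<Longrightarrow> \<exists>q. r p = Some q \<and> Y q = Some (f x)"
    and s: "s \<in> realizable C" "\<And>p x. Y p = Some x \<Longrightarrow> \<exists>q. s p = Some q \<and> Z q = Some (g x)"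
    using assms by (elim morphismE) blast
  obtain h where "h \<in> realizable C" "\<And>p q t. r p = Some q \<Longrightarrow> s q = Some t \<Longrightarrow> h p = Some t"
    using realizable_comp[OF r(1) s(1)] by blast
  then show ?thesis using r(2) s(2) by (intro morphismI[of h]) blast+
qed

lemma morphism_pair:
  assumes "morphism C X Y f" "morphism C X Z g"
  shows "morphism C X (prod_space C Y Z) (\<lambda>x. (f x, g x))"
proof -
  obtain r s where r: "r \<in> realizable C" "\<And>p x. X p = Some x \<Longrightarrow> \<exists>q. r p = Some q \<and> Y q = Some (f x)"
    and s: "s \<in> realizable C" "\<And>p x. X p = Some x \<Longrightarrow> \<exists>q. s p = Some q \<and> Z q = Some (g x)"
    using assms by (elim morphismE) blast
  obtain h where "h \<in> realizable C"
    "\<And>p q t. r p = Some q \<Longrightarrow> s p = Some t \<Longrightarrow> h p = Some (tup C (q, t))"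
    using realizable_pair[OF r(1) s(1)] by blast
  then show ?thesis using r(2) s(2)
    by (intro morphismI[of h]) (simp_all add: prod_space_eq_Some, metis untup_tup fst_conv snd_conv)
qed

lemma morphism_fst_prod: "morphism C (prod_space C X Y) X fst"
  using realizable_fst by (elim bexE, intro morphismI) (auto simp: prod_space_eq_Some)

lemma morphism_snd_prod: "morphism C (prod_space C X Y) Y snd"
  using realizable_snd by (elim bexE, intro morphismI) (auto simp: prod_space_eq_Some)

lemma morphism_fst: "morphism C X (prod_space C Y Z) f \<Longrightarrow> morphism C X Y (\<lambda>x. fst (f x))"
  by (rule morphism_comp[OF morphism_fst_prod])

lemma morphism_snd: "morphism C X (prod_space C Y Z) f \<Longrightarrow> morphism C X Z (\<lambda>x. snd (f x))"
  by (rule morphism_comp[OF morphism_snd_prod])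

lemma morphism_nat1:
  "computable F \<Longrightarrow> morphism C X (natsp C) f \<Longrightarrow> morphism C X (natsp C) (\<lambda>x. F (f x))"
  by (rule morphism_comp[OF morphism_computable])

lemma morphism_nat_pair:
  "morphism C X (natsp C) f \<Longrightarrow> morphism C X (natsp C) g \<Longrightarrow>
     morphism C X (natsp C) (\<lambda>x. prod_encode (f x, g x))"
  by (rule morphism_comp[OF morphism_prod_encode morphism_pair])

lemma morphism_nat2:
  assumes "computable (\<lambda>w. F (pfst w) (psnd w))" "morphism C X (natsp C) f" "morphism C X (natsp C) g"
  shows "morphism C X (natsp C) (\<lambda>x. F (f x) (g x))"
  using morphism_nat1[OF assms(1) morphism_nat_pair[OF assms(2,3)]] by simp

lemma morphism_value:
  "morphism C X (baire C) h \<Longrightarrow> morphism C X (natsp C) g \<Longrightarrow> morphism C X (natsp C) (\<lambda>x. h x (g x))"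
  using morphism_comp[OF morphism_apply morphism_pair] by fastforce

lemma morphism_curry:
  assumes "morphism C (prod_space C X (natsp C)) (natsp C) (\<lambda>z. g (fst z) (snd z))"
  shows "morphism C X (baire C) g"
proof -
  obtain r where r: "r \<in> realizable C" "\<And>z x n. prod_space C X (natsp C) z = Some (x, n) \<Longrightarrow>
      \<exists>v. r z = Some v \<and> natsp C v = Some (g x n)"
    using assms by (elim morphismE) (metis fst_conv snd_conv)
  obtain h where h: "h \<in> realizable C" "\<And>p g.
        (\<And>u n. natsp C u = Some n \<Longrightarrow> (\<exists>v. r (tup C (p, u)) = Some v \<and> natsp C v = Some (g n)))
        \<Longrightarrow> (\<exists>q. h p = Some q \<and> baire C q = Some g)"
    using realizable_curry[OF r(1)] by blast
  show ?thesis
    by (rule morphismI[OF h(1)]) (rule h(2), rule r(2), simp add: prod_space_eq_Some untup_tup)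
qed

abbreviation decides :: "('c, 'a) rep_space \<Rightarrow> ('a \<Rightarrow> bool) \<Rightarrow> bool" where
  "decides X P \<equiv> morphism C X (natsp C) (\<lambda>x. of_bool (P x))"

lemma of_bool_not_iff_nat: "of_bool (\<not> b) = 1 - (of_bool b :: nat)"
  by simp

lemma decides_not: "decides X P \<Longrightarrow> decides X (\<lambda>x. \<not> P x)"
  unfolding of_bool_not_iff_nat by (rule morphism_nat1[where F="\<lambda>n. 1 - n"]) (intro computable_intros)

lemma decides_conj: "decides X P \<Longrightarrow> decides X Q \<Longrightarrow> decides X (\<lambda>x. P x \<and> Q x)"
  unfolding of_bool_conj by (rule morphism_nat2[where F="(*)"]) (intro computable_intros)

lemma decides_disj: "decides X P \<Longrightarrow> decides X Q \<Longrightarrow> decides X (\<lambda>x. P x \<or> Q x)"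
  using decides_not[OF decides_conj[OF decides_not decides_not]] by simp

lemma decides_imp: "decides X P \<Longrightarrow> decides X Q \<Longrightarrow> decides X (\<lambda>x. P x \<longrightarrow> Q x)"
  unfolding imp_conv_disj by (intro decides_disj decides_not)

lemma decides1: "decidable P \<Longrightarrow> morphism C X (natsp C) f \<Longrightarrow> decides X (\<lambda>x. P (f x))"
  by (rule morphism_nat1)

lemma decides2:
  "decidable (\<lambda>w. P (pfst w) (psnd w)) \<Longrightarrow> morphism C X (natsp C) f \<Longrightarrow> morphism C X (natsp C) g
     \<Longrightarrow> decides X (\<lambda>x. P (f x) (g x))"
  by (rule morphism_nat2)

section \<open>\<open>\<Sigma>\<^sup>0\<^sub>2\<close> subobjects in normal form\<close>

lemma sub_le_trans: assumes "sub_le C A B" "sub_le C B D" shows "sub_le C A D"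
  using assms morphism_comp[of B D "\<lambda>x. x" A "\<lambda>x. x"] unfolding sub_le_def by auto

lemma sub_equiv_trans: "sub_equiv C A B \<Longrightarrow> sub_equiv C B D \<Longrightarrow> sub_equiv C A D"
  unfolding sub_equiv_def using sub_le_trans by blast

lemma witnessed_union_mono:
  assumes "uniform_le C A B" shows "sub_le C (witnessed_union C A) (witnessed_union C B)"
proof -
  obtain r where r: "r \<in> realizable C" "\<And>n u p x. natsp C u = Some n \<Longrightarrow> A n p = Some x \<Longrightarrow>
      \<exists>q. r (tup C (u, p)) = Some q \<and> B n q = Some x"
    using assms unfolding uniform_le_def by blast
  obtain f where f: "f \<in> realizable C" "\<And>p. f p = Some (fst (untup C p))"
    using realizable_fst by blast
  obtain h where h: "h \<in> realizable C"
    "\<And>p q s. f p = Some q \<Longrightarrow> r p = Some s \<Longrightarrow> h p = Some (tup C (q, s))"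
    using realizable_pair[OF f(1) r(1)] by blast
  show ?thesis
  proof (rule sub_leI[OF h(1)])
    fix z x assume "witnessed_union C A z = Some x"
    then obtain n where n: "natsp C (fst (untup C z)) = Some n" "A n (snd (untup C z)) = Some x"
      unfolding witnessed_union_eq_Some by blast
    then obtain q where "r z = Some q" "B n q = Some x" using r(2)[OF n] by (auto simp: tup_untup)
    then show "\<exists>q. h z = Some q \<and> witnessed_union C B q = Some x"
      using h(2)[OF f(2)] n by (auto simp: witnessed_union_eq_Some untup_tup)
  qed
qed

text \<open>The \<open>\<Sigma>\<^sup>0\<^sub>2\<close> subobject \<open>{x. \<exists>n. \<forall>k. f(n, x, k) = 0}\<close> given directly by its matrix: a name is a name of a
  witness \<open>n\<close> together with a name of \<open>x\<close>.\<close>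

definition Pi01_union :: "(nat \<times> (nat \<Rightarrow> nat) \<times> nat \<Rightarrow> nat) \<Rightarrow> ('c, nat \<Rightarrow> nat) rep_space" where
  "Pi01_union f = witnessed_union C (\<lambda>n. subspace_of (baire C) {x. \<forall>k. f (n, x, k) = 0})"

abbreviation matrix_space :: "('c, nat \<times> (nat \<Rightarrow> nat) \<times> nat) rep_space" where
  "matrix_space \<equiv> prod_space C (natsp C) (prod_space C (baire C) (natsp C))"

lemma Pi01_union_eq_Some:
  "Pi01_union f z = Some x \<longleftrightarrow>
     (\<exists>n. prod_space C (natsp C) (baire C) z = Some (n, x) \<and> (\<forall>k. f (n, x, k) = 0))"
  by (auto simp: Pi01_union_def witnessed_union_eq_Some subspace_of_eq_Some prod_space_eq_Some)

lemma uniformly_Pi01_subspaces: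
  assumes "morphism C matrix_space (natsp C) f"
  shows "uniformly_Pi01 C (\<lambda>n. subspace_of (baire C) {x. \<forall>k. f (n, x, k) = 0})"
proof -
  have "subobject C (subspace_of (baire C) S) (baire C)" for S
    using realizable_id by (auto simp: subobject_def subspace_of_eq_Some ran_def)
  moreover have "uniform_le C B B" for B :: "nat \<Rightarrow> ('c, nat \<Rightarrow> nat) rep_space"
    using realizable_snd unfolding uniform_le_def by (metis untup_tup snd_conv)
  ultimately show ?thesis using assms unfolding uniformly_Pi01_def uniform_equiv_def by blast
qed

text \<open>Up to equivalence, it is enough to consider witnessed unions of honest subspaces, because
  uniformly equivalent sequences have equivalent witnessed unions.\<close>

lemma Sigma02_iff:
  "Sigma02 C A \<longleftrightarrow> subobject C A (baire C)
     \<and> (\<exists>f. morphism C matrix_space (natsp C) f \<and> sub_equiv C A (Pi01_union f))"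
proof
  assume A: "Sigma02 C A"
  then obtain B where B: "uniformly_Pi01 C B" "sub_equiv C A (witnessed_union C B)"
    unfolding Sigma02_def by blast
  then obtain f where f: "morphism C matrix_space (natsp C) f"
    "uniform_equiv C B (\<lambda>n. subspace_of (baire C) {x. \<forall>k. f (n, x, k) = 0})"
    unfolding uniformly_Pi01_def by blast
  then have "sub_equiv C (witnessed_union C B) (Pi01_union f)"
    unfolding sub_equiv_def uniform_equiv_def Pi01_union_def using witnessed_union_mono by blast
  with A B f show "subobject C A (baire C)
     \<and> (\<exists>f. morphism C matrix_space (natsp C) f \<and> sub_equiv C A (Pi01_union f))"
    unfolding Sigma02_def using sub_equiv_trans by blast
next
  assume "subobject C A (baire C)
     \<and> (\<exists>f. morphism C matrix_space (natsp C) f \<and> sub_equiv C A (Pi01_union f))"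
  then show "Sigma02 C A"
    unfolding Sigma02_def Pi01_union_def using uniformly_Pi01_subspaces by blast
qed

text \<open>Precompose \<open>r\<^sub>-\<close> with the realizer of \<open>A \<subseteq> A'\<close>, and postcompose \<open>r\<^sub>+\<close> with that of \<open>A' \<subseteq> A\<close>.\<close>

lemma many_one_reducible_cong:
  assumes eq: "sub_equiv C A A'" and red: "many_one_reducible C X A' Y B"
  shows "many_one_reducible C X A Y B"
proof -
  from red obtain \<phi> m p where m: "morphism C X Y \<phi>" "m \<in> realizable C" "p \<in> realizable C"
    and iff: "\<And>x. x \<in> ran X \<Longrightarrow> x \<in> ran A' \<longleftrightarrow> \<phi> x \<in> ran B"
    and to_B: "\<And>q x. A' q = Some x \<Longrightarrow> \<exists>s. m q = Some s \<and> B s = Some (\<phi> x)"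
    and from_B: "\<And>q s x. x \<in> ran A' \<Longrightarrow> X q = Some x \<Longrightarrow> B s = Some (\<phi> x)
      \<Longrightarrow> \<exists>t. p (tup C (q, s)) = Some t \<and> A' t = Some x"
    unfolding many_one_reducible_def by blast
  have ran: "ran A = ran A'" using eq unfolding sub_equiv_def sub_le_def by blast
  obtain r r' where r: "r \<in> realizable C" "\<And>p x. A p = Some x \<Longrightarrow> \<exists>q. r p = Some q \<and> A' q = Some x"
    and r': "r' \<in> realizable C" "\<And>p x. A' p = Some x \<Longrightarrow> \<exists>q. r' p = Some q \<and> A q = Some x"
    using eq unfolding sub_equiv_def by (elim conjE sub_leE) blast
  obtain m' where m': "m' \<in> realizable C" "\<And>p q t. r p = Some q \<Longrightarrow> m q = Some t \<Longrightarrow> m' p = Some t"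
    using realizable_comp[OF r(1) m(2)] by blast
  obtain p' where p': "p' \<in> realizable C" "\<And>z q t. p z = Some q \<Longrightarrow> r' q = Some t \<Longrightarrow> p' z = Some t"
    using realizable_comp[OF m(3) r'(1)] by blast
  show ?thesis
    unfolding many_one_reducible_def ran
  proof (intro exI conjI)
    show "\<forall>q x. A q = Some x \<longrightarrow> (\<exists>s. m' q = Some s \<and> B s = Some (\<phi> x))"
      using r(2) to_B m'(2) by blast
    show "\<forall>q s x. x \<in> ran A' \<and> X q = Some x \<and> B s = Some (\<phi> x)
       \<longrightarrow> (\<exists>t. p' (tup C (q, s)) = Some t \<and> A t = Some x)"
      using r'(2) from_B p'(2) by blast
  qed (use m m' p' iff in auto)
qed

end

section \<open>Kleene's first algebra\<close>

lemma computable_realizable_K1: "computable f \<Longrightarrow> (\<lambda>n. Some (f n)) \<in> realizable K1"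
  by (simp add: K1_def computable_def)

lemma eval_prog_realizable_K1: "eval_prog c \<in> realizable K1"
  by (auto simp: K1_def partial_computable_def)

text \<open>Application is realized by the universal program and currying by parametrization.\<close>

theorem effective_coding_K1: "effective_coding K1"
proof
  fix f g assume "f \<in> realizable K1" "g \<in> realizable K1"
  then obtain c d where cd: "f = eval_prog c" "g = eval_prog d"
    by (auto simp: K1_def partial_computable_def)
  show "\<exists>h\<in>realizable K1. \<forall>p q s. f p = Some q \<and> g q = Some s \<longrightarrow> h p = Some s"
    by (rule bexI[OF _ eval_prog_realizable_K1[of "Compose d c"]]) (auto simp: cd)
  show "\<exists>h\<in>realizable K1. \<forall>p q s. f p = Some q \<and> g p = Some s \<longrightarrow> h p = Some (tup K1 (q, s))"
    by (rule bexI[OF _ eval_prog_realizable_K1[of "Tuple c d"]]) (auto simp: cd K1_def)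
next
  show "\<exists>h\<in>realizable K1. \<forall>p. h p = Some p"
    by (rule bexI[OF _ computable_realizable_K1[of "\<lambda>p. p"]]) (auto intro: computable_intros)
  show "\<exists>h\<in>realizable K1. \<forall>p. h p = Some (fst (untup K1 p))"
    by (rule bexI[OF _ computable_realizable_K1[of pfst]]) (auto intro: computable_intros simp: K1_def)
  show "\<exists>h\<in>realizable K1. \<forall>p. h p = Some (snd (untup K1 p))"
    by (rule bexI[OF _ computable_realizable_K1[of psnd]]) (auto intro: computable_intros simp: K1_def)
next
  fix g assume "computable g"
  then show "morphism K1 (natsp K1) (natsp K1) g"
    by (intro morphismI[OF computable_realizable_K1[of g]]) (auto simp: K1_def)
next
  show "morphism K1 (prod_space K1 (natsp K1) (natsp K1)) (natsp K1) prod_encode"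
  proof (rule morphismI[OF computable_realizable_K1[OF computable_id]])
    fix z ab assume z: "prod_space K1 (natsp K1) (natsp K1) z = Some ab"
    obtain a b where ab: "ab = (a, b)" by fastforce
    have "prod_decode z = ab" using z unfolding ab prod_space_eq_Some by (auto simp: K1_def prod_eq_iff)
    then have "prod_encode ab = z" using prod_decode_inverse by metis
    then show "\<exists>q. Some z = Some q \<and> natsp K1 q = Some (prod_encode ab)" by (simp add: K1_def)
  qed
next
  obtain u where u: "\<And>e n v. phi e n = Some v \<Longrightarrow> eval_prog u (prod_encode (e, n)) = Some v"
    using universal_program by blast
  have "eval_prog u z = Some (x n)" if "prod_space K1 (baire K1) (natsp K1) z = Some (x, n)" for z x n
  proof -
    have "phi (pfst z) (psnd z) = Some (x n)"
      using that by (auto simp: prod_space_eq_Some K1_def split: if_splits)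
    from u[OF this] show ?thesis by simp
  qed
  then show "morphism K1 (prod_space K1 (baire K1) (natsp K1)) (natsp K1) (\<lambda>(x, n). x n)"
    by (intro morphismI[OF eval_prog_realizable_K1[of u]]) (auto simp: K1_def)
next
  fix r assume "r \<in> realizable K1"
  then obtain c where c: "r = eval_prog c" by (auto simp: K1_def partial_computable_def)
  obtain s where s: "computable s" "\<And>p n. phi (s p) n = eval_prog c (prod_encode (p, n))"
    using parametrization[of c] by metis
  show "\<exists>h\<in>realizable K1. \<forall>p g.
      (\<forall>u n. natsp K1 u = Some n \<longrightarrow> (\<exists>v. r (tup K1 (p, u)) = Some v \<and> natsp K1 v = Some (g n)))
      \<longrightarrow> (\<exists>q. h p = Some q \<and> baire K1 q = Some g)"
    by (rule bexI[OF _ computable_realizable_K1[OF s(1)]]) (auto simp: K1_def s(2) c)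
qed (simp_all add: untup_tup(1) tup_untup(1))

section \<open>Kleene's second algebra\<close>

definition code_drop :: "nat \<Rightarrow> nat \<Rightarrow> nat" where
  "code_drop z i = rec_nat z (\<lambda>_ r. psnd (r - 1)) i"

lemma prod_decode_0: "prod_decode 0 = (0, 0)"
  using prod_encode_inverse[of "(0, 0)"] by (simp add: prod_encode_def)

lemma code_drop_list_encode: "code_drop (list_encode xs) i = list_encode (drop i xs)"
proof (induction i)
  case (Suc i)
  have "psnd (list_encode ys - 1) = list_encode (tl ys)" for ys
    by (cases ys) (simp_all add: prod_decode_0)
  then show ?case using Suc by (simp add: code_drop_def drop_Suc tl_drop)
qed (simp add: code_drop_def)

lemma computable_code_drop [computable_intros]:
  "computable f \<Longrightarrow> computable g \<Longrightarrow> computable (\<lambda>z. code_drop (f z) (g z))"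
  unfolding code_drop_def by (intro computable_intros)

lemma length_le_list_encode: "length xs \<le> list_encode xs"
proof (induction xs)
  case (Cons a xs)
  then show ?case using le_prod_encode_2[of "list_encode xs" a] by simp
qed simp

text \<open>The three parts of a query code: the argument \<open>n\<close>, the length of the prefix of \<open>x\<close>, and the prefix. Values
  beyond the prefix read as 0, the value of \<open>pfst\<close> at the code of the empty list.\<close>

definition query_arg :: "nat \<Rightarrow> nat" where "query_arg w = pfst (w - 1)"
definition query_len :: "nat \<Rightarrow> nat" where "query_len w = search w (\<lambda>k. code_drop w k = 0) - 1"
definition query_val :: "nat \<Rightarrow> nat \<Rightarrow> nat" where "query_val w i = pfst (code_drop w (Suc i) - 1)"

lemma query_arg_query [simp]: "query_arg (query n x m) = n"
  by (simp add: query_arg_def query_def)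

lemma query_len_query [simp]: "query_len (query n x m) = m"
proof -
  have e: "list_encode xs = 0 \<longleftrightarrow> xs = []" for xs by (cases xs) auto
  have "search (query n x m) (\<lambda>k. code_drop (query n x m) k = 0) = Suc m"
    using length_le_list_encode[of "n # map x [0..<m]"]
    by (intro search_eqI) (auto simp: query_def code_drop_list_encode e simp del: list_encode.simps)
  then show ?thesis by (simp add: query_len_def)
qed

lemma query_val_query [simp]: "query_val (query n x m) i = (if i < m then x i else 0)"
proof -
  have "pfst (list_encode ys - 1) = (case ys of [] \<Rightarrow> 0 | y # _ \<Rightarrow> y)" for ys
    by (cases ys) (simp_all add: prod_decode_0)
  moreover have "drop i (map x [0..<m]) = (if i < m then x i # map x [Suc i..<m] else [])"
    by (auto simp: drop_map upt_conv_Cons)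
  ultimately show ?thesis
    by (simp add: query_val_def query_def code_drop_list_encode del: list_encode.simps)
qed

lemma computable_query_arg [computable_intros]: "computable f \<Longrightarrow> computable (\<lambda>z. query_arg (f z))"
  unfolding query_arg_def by (intro computable_intros)

lemma computable_query_len [computable_intros]:
  assumes "computable f" shows "computable (\<lambda>z. query_len (f z))"
  by (rule computable_compose[OF _ assms]) (unfold query_len_def, intro computable_intros)

lemma computable_query_val [computable_intros]:
  "computable f \<Longrightarrow> computable g \<Longrightarrow> computable (\<lambda>z. query_val (f z) (g z))"
  unfolding query_val_def by (intro computable_intros)

lemma computable_query [computable_intros]:
  assumes "computable n" "computable (\<lambda>w. x (pfst w) (psnd w))" "computable m"
  shows "computable (\<lambda>z. query (n z) (x z) (m z))"
proof -
  have "rec_nat 0 (\<lambda>k r. Suc (prod_encode (y (j - Suc k), r))) i = list_encode (map y [j - i..<j])"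
    if "i \<le> j" for i j and y :: "nat \<Rightarrow> nat"
    using that by (induction i) (auto simp: upt_conv_Cons Suc_diff_Suc[symmetric] simp del: upt_Suc)
  from this[OF order_refl]
  have "query k y j = Suc (prod_encode (k, rec_nat 0 (\<lambda>k r. Suc (prod_encode (y (j - Suc k), r))) j))"
    for k j y by (simp add: query_def)
  then show ?thesis
    by (simp only:) (intro computable_intros assms computable_compose2[where F=x, OF assms(2)]
        computable_compose[OF assms(3)])
qed

lemma query_cong:
  assumes "\<And>i. i < m \<Longrightarrow> x i = y i" shows "query n x m = query n y m"
proof -
  have "map x [0..<m] = map y [0..<m]" using assms by (intro map_cong) auto
  then show ?thesis by (simp only: query_def)
qed

lemma kapp_eq_Some:
  "kapp p x = Some y \<longleftrightarrow>
     (\<forall>n. \<exists>m. p (query n x m) = Suc (y n) \<and> (\<forall>j<m. p (query n x j) = 0))" (is "?L \<longleftrightarrow> ?R")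
proof
  assume L: ?L
  show ?R
  proof
    fix n
    let ?m = "LEAST m. p (query n x m) > 0"
    from L have ex: "\<exists>m. p (query n x m) > 0" and y: "y n = p (query n x ?m) - 1"
      by (auto simp: kapp_def split: if_splits)
    from LeastI_ex[OF ex] have "p (query n x ?m) = Suc (y n)" using y by simp
    moreover have "\<forall>j<?m. p (query n x j) = 0" using not_less_Least by blast
    ultimately show "\<exists>m. p (query n x m) = Suc (y n) \<and> (\<forall>j<m. p (query n x j) = 0)" by blast
  qed
next
  assume R: ?R
  have "p (query n x (LEAST m. p (query n x m) > 0)) = Suc (y n)" for n
  proof -
    obtain m where m: "p (query n x m) = Suc (y n)" "\<And>j. j < m \<Longrightarrow> p (query n x j) = 0" using R by blast
    have "(LEAST m. p (query n x m) > 0) = m"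
      using m by (intro Least_equality leI) (simp, metis less_irrefl)
    then show ?thesis using m by simp
  qed
  then show ?L by (auto simp: kapp_def) (metis zero_less_Suc)
qed

text \<open>Sufficient when the associate is consistent: every positive answer is the right one, so it does not
  matter at which prefix length the first one occurs.\<close>

lemma kapp_eqI:
  assumes "\<And>n. \<exists>m. p (query n x m) > 0"
    and "\<And>n m. p (query n x m) > 0 \<Longrightarrow> p (query n x m) = Suc (y n)"
  shows "kapp p x = Some y"
  unfolding kapp_eq_Some
proof
  fix n
  let ?m = "LEAST m. p (query n x m) > 0"
  have "p (query n x ?m) > 0" using assms(1) by (rule LeastI_ex)
  moreover have "\<forall>j<?m. p (query n x j) = 0" using not_less_Least by blast
  ultimately show "\<exists>m. p (query n x m) = Suc (y n) \<and> (\<forall>j<m. p (query n x j) = 0)"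
    using assms(2) by blast
qed

text \<open>Each output value may consult the input at 0 and 1 and at one further place, which may depend on the
  value at 1. This covers the identity, the projections of an interleaved pair, functions on names of numbers,
  and application, where the value at 1 is the argument of the function interleaved at the even places.\<close>

lemma computable_associate:
  assumes H: "computable (\<lambda>w. H (pfst w) (pfst (psnd w)) (pfst (psnd (psnd w))) (psnd (psnd (psnd w))))"
    and t: "computable (\<lambda>w. t (pfst w) (psnd w))"
  obtains p where "computable p" "\<And>x. kapp p x = Some (\<lambda>n. H n (x 0) (x 1) (x (t n (x 1))))"
proof
  let ?t = "\<lambda>w. t (query_arg w) (query_val w 1)"
  let ?p = "\<lambda>w. if 1 < query_len w \<and> ?t w < query_len w
    then Suc (H (query_arg w) (query_val w 0) (query_val w 1) (query_val w (?t w))) else 0"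
  have ct: "computable ?t" by (rule computable_compose2[where F=t, OF t]) (intro computable_intros)+
  have cH: "computable (\<lambda>w. H (query_arg w) (query_val w 0) (query_val w 1) (query_val w (?t w)))"
  proof -
    have "computable (\<lambda>w. prod_encode (query_arg w, prod_encode (query_val w 0,
        prod_encode (query_val w 1, query_val w (?t w)))))"
      by (intro computable_intros ct)
    from computable_compose[OF H this] show ?thesis by simp
  qed
  show "computable ?p" by (intro computable_intros ct cH)
  show "kapp ?p x = Some (\<lambda>n. H n (x 0) (x 1) (x (t n (x 1))))" for x
  proof (rule kapp_eqI)
    fix n
    show "\<exists>m. 0 < ?p (query n x m)"
      by (rule exI[of _ "2 + t n (x 1)"]) simp
    show "?p (query n x m) = Suc (H n (x 0) (x 1) (x (t n (x 1))))" if "0 < ?p (query n x m)" for m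
      using that by (auto split: if_splits)
  qed
qed

text \<open>Composition of associates. From the prefix coded in \<open>w\<close>, \<open>probe p w i\<close> is \<open>y(i) + 1\<close> if the prefix already
  determines the value at \<open>i\<close> of \<open>y = p \<^bold>* x\<close>, and 0 otherwise. The composite answers once it finds a
  prefix of \<open>y\<close> on which \<open>q\<close> answers and all of whose entries are determined.\<close>

definition probe :: "(nat \<Rightarrow> nat) \<Rightarrow> nat \<Rightarrow> nat \<Rightarrow> nat" where
  "probe p w i = p (query i (query_val w)
     (search (query_len w) (\<lambda>j. 0 < p (query i (query_val w) j))))"

definition compose_associate :: "(nat \<Rightarrow> nat) \<Rightarrow> (nat \<Rightarrow> nat) \<Rightarrow> nat \<Rightarrow> nat" where
  "compose_associate q p w =
     (let y = (\<lambda>i. probe p w i - 1);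
          l = search (query_len w) (\<lambda>l. 0 < q (query (query_arg w) y l))
      in if \<forall>i<l. 0 < probe p w i then q (query (query_arg w) y l) else 0)"

lemma computable_probe:
  assumes p: "computable p" and "computable f" "computable g"
  shows "computable (\<lambda>z. probe p (f z) (g z))"
  by (rule computable_compose2[OF _ assms(2,3)])
    (unfold probe_def, intro computable_intros computable_compose[OF p])

lemma computable_compose_associate:
  assumes "computable q" "computable p"
  shows "computable (compose_associate q p)"
  unfolding compose_associate_def[abs_def] Let_def
  by (intro computable_intros computable_compose[OF assms(1)] computable_probe[OF assms(2)])

text \<open>In the search for the length \<open>l\<close>, undetermined entries of \<open>y\<close> read as 0 and may produce a spurious hit; the
  final check on the entries below \<open>l\<close> discards it. Once the prefix of \<open>x\<close> determines all entries below the
  true length \<open>L\<close>, the search finds \<open>L\<close>.\<close>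

lemma kapp_compose_associate:
  assumes p: "kapp p x = Some y" and q: "kapp q y = Some z"
  shows "kapp (compose_associate q p) x = Some z"
proof (rule kapp_eqI)
  fix n
  obtain M where M: "\<And>i. p (query i x (M i)) = Suc (y i)" "\<And>i j. j < M i \<Longrightarrow> p (query i x j) = 0"
    using p unfolding kapp_eq_Some by metis
  obtain L where L: "q (query n y L) = Suc (z n)" "\<And>j. j < L \<Longrightarrow> q (query n y j) = 0"
    using q unfolding kapp_eq_Some by metis
  have query_prefix: "query i (query_val (query n x m)) j = query i x j" if "j \<le> m" for i j m
    using that by (intro query_cong) simp
  define s where "s m i = search m (\<lambda>j. 0 < p (query i (query_val (query n x m)) j))" for m i
  have probe: "probe p (query n x m) i = p (query i x (s m i))" for m i
    unfolding probe_def s_def by (simp add: query_prefix search_le)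
  have s_M: "s m i = M i" if "M i \<le> m" for m i
    unfolding s_def using that M by (intro search_eqI) (simp_all add: query_prefix)
  have sound: "probe p (query n x m) i = Suc (y i)" if pos: "0 < probe p (query n x m) i" for m i
  proof -
    have "M i \<le> s m i" using pos M(2)[of "s m i" i] unfolding probe by (cases "s m i < M i") simp_all
    also have "\<dots> \<le> m" unfolding s_def by (rule search_le)
    finally show ?thesis using s_M M(1) by (simp add: probe)
  qed
  define Y where "Y m i = probe p (query n x m) i - 1" for m i
  define l where "l m = search m (\<lambda>l. 0 < q (query n (Y m) l))" for m
  have assoc_eq: "compose_associate q p (query n x m) =
      (if \<forall>i<l m. 0 < probe p (query n x m) i then q (query n (Y m) (l m)) else 0)" for m
    unfolding compose_associate_def Let_def l_def Y_def[abs_def] query_arg_query query_len_query ..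
  show "compose_associate q p (query n x m) = Suc (z n)"
    if pos: "0 < compose_associate q p (query n x m)" for m
  proof -
    from pos have "\<And>i. i < l m \<Longrightarrow> 0 < probe p (query n x m) i" unfolding assoc_eq
      by (simp split: if_splits)
    then have "\<And>i. i < l m \<Longrightarrow> Y m i = y i" by (simp add: Y_def sound)
    then have qY: "query n (Y m) j = query n y j" if "j \<le> l m" for j
      using that by (intro query_cong) simp
    from pos have ql: "0 < q (query n y (l m))" unfolding assoc_eq using qY[OF order_refl]
      by (simp split: if_splits)
    have "L \<le> l m" using ql L(2)[of "l m"] by (cases "l m < L") simp_all
    moreover have "\<not> L < l m"
      using search_minimal[of L m "\<lambda>l. 0 < q (query n (Y m) l)"] qY[of L] L(1)
      unfolding l_def[symmetric] by auto
    ultimately have "l m = L" by simp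
    then show ?thesis using pos qY[of L] L(1) unfolding assoc_eq by (simp split: if_splits)
  qed
  define m where "m = L + (\<Sum>i<L. M i)"
  have "M i \<le> m" if "i < L" for i
    using member_le_sum[of i "{..<L}" M] that unfolding m_def by simp
  then have pr: "probe p (query n x m) i = Suc (y i)" if "i < L" for i
    using that s_M M(1) by (simp add: probe)
  then have qY: "query n (Y m) j = query n y j" if "j \<le> L" for j
    using that by (intro query_cong) (simp add: Y_def)
  have "l m = L" unfolding l_def using L qY by (intro search_eqI) (simp_all add: m_def)
  then show "\<exists>m. 0 < compose_associate q p (query n x m)"
    using pr qY L(1) by (intro exI[of _ m]) (simp add: assoc_eq)
qed

text \<open>The even outputs of the interleaved pair come from \<open>p\<close>, the odd ones from \<open>q\<close>.\<close>

definition pair_associate :: "(nat \<Rightarrow> nat) \<Rightarrow> (nat \<Rightarrow> nat) \<Rightarrow> nat \<Rightarrow> nat" where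
  "pair_associate p q w =
     (let v = query (query_arg w div 2) (query_val w) (query_len w)
      in if query_arg w mod 2 = 0 then p v else q v)"

lemma computable_pair_associate:
  assumes "computable p" "computable q" shows "computable (pair_associate p q)"
  unfolding pair_associate_def[abs_def] Let_def
  by (intro computable_intros computable_compose[OF assms(1)] computable_compose[OF assms(2)])

lemma kapp_pair_associate:
  assumes "kapp p x = Some y" "kapp q x = Some z"
  shows "kapp (pair_associate p q) x = Some (interleave (y, z))"
proof -
  have "query i (query_val (query n x m)) m = query i x m" for i n m by (intro query_cong) simp
  then have "pair_associate p q (query n x m) =
      (if even n then p (query (n div 2) x m) else q (query (n div 2) x m))" for n m
    by (simp add: pair_associate_def Let_def even_iff_mod_2_eq_zero)
  then show ?thesis using assms unfolding kapp_eq_Some by (simp add: interleave_def)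
qed

text \<open>The argument \<open>n\<close> of the query supplies the second component \<open>n000\<dots>\<close> of the pair. A prefix of length \<open>m\<close>
  of the interleaving uses at most the first \<open>m\<close> entries of \<open>x\<close>, so prefixes of equal length correspond, and
  the associate \<open>p\<close> is queried step by step as in its own evaluation.\<close>

definition curry_associate :: "(nat \<Rightarrow> nat) \<Rightarrow> nat \<Rightarrow> nat" where
  "curry_associate p w = p (query 0
     (\<lambda>i. if i mod 2 = 0 then query_val w (i div 2) else if i div 2 = 0 then query_arg w else 0)
     (query_len w))"

lemma computable_curry_associate:
  assumes "computable p" shows "computable (curry_associate p)"
  unfolding curry_associate_def[abs_def] by (intro computable_intros computable_compose[OF assms])

lemma kapp_curry_associate:
  assumes "\<And>n. \<exists>v. kapp p (interleave (x, \<lambda>i. if i = 0 then n else 0)) = Some v \<and> v 0 = g n"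
  shows "kapp (curry_associate p) x = Some g"
proof -
  have "curry_associate p (query n x m) = p (query 0 (interleave (x, \<lambda>i. if i = 0 then n else 0)) m)"
    for n m unfolding curry_associate_def query_arg_query query_len_query
    by (intro arg_cong[of _ _ p] query_cong) (auto simp: interleave_def even_iff_mod_2_eq_zero)
  then show ?thesis using assms unfolding kapp_eq_Some by metis
qed

text \<open>A common form of \<^const>\<open>K2\<close> and \<^const>\<open>KV\<close>, with associates restricted to \<open>S\<close>.\<close>

definition kleene_coding :: "(nat \<Rightarrow> nat) set \<Rightarrow> (nat \<Rightarrow> nat) coding_system" where
  "kleene_coding S = \<lparr> realizable = kapp ` S, tup = interleave, untup = uninterleave,
     natsp = nat_name2, baire = (\<lambda>x. Some x) \<rparr>"

lemma K2_eq: "K2 = kleene_coding UNIV"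
  unfolding K2_def kleene_coding_def by auto

lemma KV_eq: "KV = kleene_coding (Collect computable)"
  unfolding KV_def kleene_coding_def by auto

lemma nat_name2_eq_Some: "nat_name2 u = Some n \<longleftrightarrow> u = (\<lambda>i. if i = 0 then n else 0)"
proof -
  have "nat_name2 u = Some n \<longleftrightarrow> (\<forall>k>0. u k = 0) \<and> u 0 = n" unfolding nat_name2_def by simp
  also have "\<dots> \<longleftrightarrow> (\<forall>i. u i = (if i = 0 then n else 0))" by (metis neq0_conv)
  finally show ?thesis unfolding fun_eq_iff .
qed

lemma nat_name2_SomeD: "nat_name2 u = Some n \<Longrightarrow> u 0 = n"
  by (simp add: nat_name2_eq_Some)

lemma uninterleave_interleave: "uninterleave (interleave v) = v"
  by (cases v) (simp add: uninterleave_def interleave_def)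

lemma interleave_uninterleave: "interleave (uninterleave z) = z"
  by (auto simp: uninterleave_def interleave_def)

theorem effective_coding_kleene:
  assumes S: "S = UNIV \<or> S = Collect computable"
  shows "effective_coding (kleene_coding S)"
proof -
  let ?K = "kleene_coding S"
  note K = kleene_coding_def uninterleave_interleave interleave_uninterleave
  \<comment> \<open>computable associates lie in \<open>S\<close> in both cases\<close>
  have total: "\<exists>h\<in>realizable ?K. \<forall>x. h x = Some (\<lambda>n. H n (x 0) (x 1) (x (t n (x 1))))"
    if "computable (\<lambda>w. H (pfst w) (pfst (psnd w)) (pfst (psnd (psnd w))) (psnd (psnd (psnd w))))"
      "computable (\<lambda>w. t (pfst w) (psnd w))" for H t
  proof -
    note assoc = computable_associate[OF that]
    obtain p where "computable p" "\<And>x. kapp p x = Some (\<lambda>n. H n (x 0) (x 1) (x (t n (x 1))))"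
      using assoc by blast
    then show ?thesis using S by (intro bexI[of _ "kapp p"]) (auto simp: K)
  qed
  show ?thesis
  proof
    fix f g assume "f \<in> realizable ?K" "g \<in> realizable ?K"
    then obtain p q where pq: "p \<in> S" "q \<in> S" "f = kapp p" "g = kapp q" by (auto simp: K)
    have "compose_associate q p \<in> S" using S pq computable_compose_associate by auto
    then show "\<exists>h\<in>realizable ?K. \<forall>p q s. f p = Some q \<and> g q = Some s \<longrightarrow> h p = Some s"
      using kapp_compose_associate pq
      by (intro bexI[of _ "kapp (compose_associate q p)"]) (auto simp: K)
    have "pair_associate p q \<in> S" using S pq computable_pair_associate by auto
    then show "\<exists>h\<in>realizable ?K. \<forall>p q s. f p = Some q \<and> g p = Some s \<longrightarrow> h p = Some (tup ?K (q, s))"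
      using kapp_pair_associate pq
      by (intro bexI[of _ "kapp (pair_associate p q)"]) (auto simp: K)
  next
    have c: "computable (\<lambda>w. psnd (psnd (psnd w)))" "computable (\<lambda>w. pfst w)"
      "computable (\<lambda>w. 2 * pfst w)" "computable (\<lambda>w. 2 * pfst w + 1)"
      by (intro computable_intros)+
    show "\<exists>h\<in>realizable ?K. \<forall>p. h p = Some p"
      using total[of "\<lambda>n a b c. c" "\<lambda>n b. n", OF c(1,2)] .
    show "\<exists>h\<in>realizable ?K. \<forall>p. h p = Some (fst (untup ?K p))"
      using total[of "\<lambda>n a b c. c" "\<lambda>n b. 2 * n", OF c(1,3)] by (simp add: K uninterleave_def)
    show "\<exists>h\<in>realizable ?K. \<forall>p. h p = Some (snd (untup ?K p))"
      using total[of "\<lambda>n a b c. c" "\<lambda>n b. 2 * n + 1", OF c(1,4)] by (simp add: K uninterleave_def)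
  next
    fix g assume g: "computable g"
    have "computable (\<lambda>w. if pfst w = 0 then g (pfst (psnd w)) else 0)"
      by (intro computable_intros computable_compose[OF g])
    from total[of "\<lambda>n a b c. if n = 0 then g a else 0" "\<lambda>n b. 0", OF this computable_const]
    obtain h where h: "h \<in> realizable ?K" "\<And>x. h x = Some (\<lambda>n. if n = 0 then g (x 0) else 0)" by blast
    show "morphism ?K (natsp ?K) (natsp ?K) g"
      by (rule morphismI[OF h(1)]) (auto simp: h(2) K nat_name2_eq_Some)
  next
    have "computable (\<lambda>w. if pfst w = 0 then prod_encode (pfst (psnd w), pfst (psnd (psnd w))) else 0)"
      by (intro computable_intros)
    from total[of "\<lambda>n a b c. if n = 0 then prod_encode (a, b) else 0" "\<lambda>n b. 0", OF this computable_const]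
    obtain h where h: "h \<in> realizable ?K"
      "\<And>x. h x = Some (\<lambda>n. if n = 0 then prod_encode (x 0, x 1) else 0)" by blast
    show "morphism ?K (prod_space ?K (natsp ?K) (natsp ?K)) (natsp ?K) prod_encode"
    proof (rule morphismI[OF h(1)])
      fix z ab assume z: "prod_space ?K (natsp ?K) (natsp ?K) z = Some ab"
      obtain a b where ab: "ab = (a, b)" by fastforce
      have "z 0 = a" "z 1 = b" using z
        by (auto simp: ab prod_space_eq_Some K uninterleave_def dest: nat_name2_SomeD)
      then show "\<exists>q. h z = Some q \<and> natsp ?K q = Some (prod_encode ab)"
        by (simp add: h(2) K nat_name2_eq_Some ab cong: if_cong)
    qed
  next
    have "computable (\<lambda>w. if pfst w = 0 then psnd (psnd (psnd w)) else 0)"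
      "computable (\<lambda>w. 2 * psnd w)" by (intro computable_intros)+
    from total[of "\<lambda>n a b c. if n = 0 then c else 0" "\<lambda>n b. 2 * b", OF this]
    obtain h where h: "h \<in> realizable ?K"
      "\<And>x. h x = Some (\<lambda>n. if n = 0 then x (2 * x 1) else 0)" by blast
    show "morphism ?K (prod_space ?K (baire ?K) (natsp ?K)) (natsp ?K) (\<lambda>(x, n). x n)"
    proof (rule morphismI[OF h(1)])
      fix z xn assume z: "prod_space ?K (baire ?K) (natsp ?K) z = Some xn"
      obtain x n where xn: "xn = (x, n)" by fastforce
      have "x = (\<lambda>i. z (2 * i))" "z 1 = n" using z
        by (auto simp: xn prod_space_eq_Some K uninterleave_def dest: nat_name2_SomeD)
      then show "\<exists>q. h z = Some q \<and> natsp ?K q = Some (case xn of (x, n) \<Rightarrow> x n)"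
        by (simp add: h(2) K nat_name2_eq_Some xn cong: if_cong)
    qed
  next
    fix r assume "r \<in> realizable ?K"
    then obtain p where p: "p \<in> S" "r = kapp p" by (auto simp: K)
    have "curry_associate p \<in> S" using S p computable_curry_associate by auto
    moreover have "kapp (curry_associate p) x = Some g"
      if "\<forall>u n. natsp ?K u = Some n \<longrightarrow> (\<exists>v. r (tup ?K (x, u)) = Some v \<and> natsp ?K v = Some (g n))"
      for x g
      using that p(2) by (intro kapp_curry_associate) (fastforce simp: K nat_name2_eq_Some)
    ultimately show "\<exists>h\<in>realizable ?K. \<forall>p g.
        (\<forall>u n. natsp ?K u = Some n \<longrightarrow> (\<exists>v. r (tup ?K (p, u)) = Some v \<and> natsp ?K v = Some (g n)))
        \<longrightarrow> (\<exists>q. h p = Some q \<and> baire ?K q = Some g)"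
      by (intro bexI[of _ "kapp (curry_associate p)"]) (auto simp: K)
  qed (simp_all add: K)
qed

section \<open>Gaps in linear orders\<close>

text \<open>A single instance of the axioms of a linear order with a gap between the two numbers coded in \<open>n\<close>. It
  consults finitely many values of \<open>x\<close>, so it is decidable, and its universal closure is the \<open>\<Pi>\<^sup>0\<^sub>1\<close> matrix of
  \<^const>\<open>NonDense\<close>. Reflexivity on the domain holds by the definition of the domain, and membership of both ends in
  it follows from the second conjunct.\<close>

definition gap_test :: "nat \<Rightarrow> (nat \<Rightarrow> nat) \<Rightarrow> nat \<Rightarrow> nat \<Rightarrow> nat \<Rightarrow> bool" where
  "gap_test n x c d e \<longleftrightarrow>
     (let R = (\<lambda>u v. x (prod_encode (u, v)) = 1); a = pfst n; b = psnd n in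
       x c \<le> 1
     \<and> (R c d \<longrightarrow> R c c \<and> R d d)
     \<and> (R c d \<and> R d e \<longrightarrow> R c e)
     \<and> (R c d \<and> R d c \<longrightarrow> c = d)
     \<and> (R c c \<and> R d d \<longrightarrow> R c d \<or> R d c)
     \<and> R a b \<and> a \<noteq> b
     \<and> (R c c \<longrightarrow> R c a \<or> R b c))"

lemma gap_test_iff:
  "(\<forall>c d e. gap_test n x c d e) \<longleftrightarrow> codes_linear_order x \<and> gap x (pfst n) (psnd n)"
proof
  assume "\<forall>c d e. gap_test n x c d e"
  then have t: "\<And>c d e. gap_test n x c d e" by blast
  let ?R = "order_rel x"
  have R: "x (prod_encode (u, v)) = 1 \<longleftrightarrow> (u, v) \<in> ?R" for u v by (simp add: order_rel_def)
  note t = t[unfolded gap_test_def Let_def R]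
  have le: "x i \<le> 1" for i by (rule t[THEN conjunct1])
  have dom: "(c, c) \<in> ?R \<and> (d, d) \<in> ?R" if "(c, d) \<in> ?R" for c d using t[of c d] that by simp
  have trans: "(c, e) \<in> ?R" if "(c, d) \<in> ?R" "(d, e) \<in> ?R" for c d e using t[of c d e] that by simp
  have antisym: "c = d" if "(c, d) \<in> ?R" "(d, c) \<in> ?R" for c d using t[of c d] that by simp
  have total: "(c, d) \<in> ?R \<or> (d, c) \<in> ?R" if "(c, c) \<in> ?R" "(d, d) \<in> ?R" for c d
    using t[of c d] that by simp
  have ends: "(pfst n, psnd n) \<in> ?R" "pfst n \<noteq> psnd n" using t by simp_all
  have between: "(c, pfst n) \<in> ?R \<or> (psnd n, c) \<in> ?R" if "(c, c) \<in> ?R" for c using t[of c] that by simp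
  have "x i \<in> {0, 1}" for i using le[of i] by (auto simp: le_Suc_eq)
  moreover have "?R \<subseteq> order_dom x \<times> order_dom x"
    unfolding order_dom_def by (auto dest: dom)
  moreover have "refl_on (order_dom x) ?R"
    unfolding refl_on_def order_dom_def by blast
  moreover have "trans ?R" by (rule transI) (rule trans)
  moreover have "antisym ?R" by (rule antisymI) (rule antisym)
  moreover have "total_on (order_dom x) ?R" unfolding total_on_def order_dom_def using total by blast
  ultimately have "codes_linear_order x"
    unfolding codes_linear_order_def linear_order_on_def partial_order_on_def preorder_on_def by blast
  moreover have "gap x (pfst n) (psnd n)"
    unfolding gap_def order_less_def order_dom_def using ends dom[OF ends(1)] between by blast
  ultimately show "codes_linear_order x \<and> gap x (pfst n) (psnd n)" ..
next
  assume x: "codes_linear_order x \<and> gap x (pfst n) (psnd n)"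
  let ?R = "order_rel x"
  have R: "x (prod_encode (u, v)) = 1 \<longleftrightarrow> (u, v) \<in> ?R" for u v by (simp add: order_rel_def)
  have le: "x i \<le> 1" for i using x unfolding codes_linear_order_def by (auto simp: le_Suc_eq)
  have lin: "linear_order_on (order_dom x) ?R" using x unfolding codes_linear_order_def by blast
  have "?R \<subseteq> order_dom x \<times> order_dom x"
    using lin unfolding linear_order_on_def partial_order_on_def preorder_on_def by blast
  then have dom: "(c, c) \<in> ?R \<and> (d, d) \<in> ?R" if "(c, d) \<in> ?R" for c d
    using that unfolding order_dom_def by blast
  have trans: "(c, e) \<in> ?R" if "(c, d) \<in> ?R" "(d, e) \<in> ?R" for c d e
    using lin that unfolding linear_order_on_def partial_order_on_def preorder_on_def by (meson transD)
  have antisym: "c = d" if "(c, d) \<in> ?R" "(d, c) \<in> ?R" for c d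
    using lin that unfolding linear_order_on_def partial_order_on_def by (meson antisymD)
  have total: "(c, d) \<in> ?R \<or> (d, c) \<in> ?R" if "(c, c) \<in> ?R" "(d, d) \<in> ?R" for c d
  proof (cases "c = d")
    case False
    have "total_on (order_dom x) ?R" using lin unfolding linear_order_on_def by blast
    then show ?thesis using that False unfolding total_on_def order_dom_def by simp
  qed (use that in simp)
  have ends: "(pfst n, psnd n) \<in> ?R" "pfst n \<noteq> psnd n"
    and between: "(c, c) \<in> ?R \<Longrightarrow> (c, pfst n) \<in> ?R \<or> (psnd n, c) \<in> ?R" for c
    using x unfolding gap_def order_less_def order_dom_def by blast+
  have "gap_test n x c d e" for c d e
    unfolding gap_test_def Let_def R
    using le[of c] dom[of c d] trans[of c d e] antisym[of c d] total[of c d] ends between[of c] by simp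
  then show "\<forall>c d e. gap_test n x c d e" by blast
qed

lemma gap_not_dense:
  assumes "codes_linear_order x" "gap x a b" shows "\<not> dense_order x"
proof
  assume "dense_order x"
  with assms(2) obtain c where c: "c \<in> order_dom x" "order_less x a c" "order_less x c b"
    and "(c, a) \<in> order_rel x \<or> (b, c) \<in> order_rel x"
    unfolding dense_order_def gap_def by blast
  moreover have "antisym (order_rel x)"
    using assms(1) unfolding codes_linear_order_def linear_order_on_def partial_order_on_def by blast
  ultimately show False unfolding order_less_def antisym_def by blast
qed

section \<open>A coded dense order with a tag on every point\<close>

text \<open>The number 0 codes the position 0, and \<open>Suc \<langle>i, m\<rangle>\<close> codes \<open>(2i + 1) / 2\<^bsup>m+1\<^esup>\<close>. The latter are exactly the
  positive dyadic rationals that are not integers, each coded once, and they are dense in \<open>[0, \<infinity>)\<close>. No position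
  is a positive integer, so the integer parts, called stages, cut them into copies of the rationals.\<close>

definition numer :: "nat \<Rightarrow> nat" where "numer c = (if c = 0 then 0 else 2 * pfst (c - 1) + 1)"
definition expon :: "nat \<Rightarrow> nat" where "expon c = (if c = 0 then 0 else psnd (c - 1) + 1)"
definition stage :: "nat \<Rightarrow> nat" where "stage c = numer c div 2 ^ expon c"
definition position :: "nat \<Rightarrow> real" where "position c = numer c / 2 ^ expon c"

lemma position_le_iff: "position c \<le> position d \<longleftrightarrow> numer c * 2 ^ expon d \<le> numer d * 2 ^ expon c"
proof -
  have "position c \<le> position d \<longleftrightarrow> real (numer c * 2 ^ expon d) \<le> real (numer d * 2 ^ expon c)"
    unfolding position_def by (simp add: field_simps)
  then show ?thesis unfolding of_nat_le_iff .
qed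

lemma position_0 [simp]: "position 0 = 0" by (simp add: position_def numer_def)

lemma position_pos: "c > 0 \<Longrightarrow> position c > 0" by (simp add: position_def numer_def)

text \<open>A fraction with odd numerator and denominator a power of two is in lowest terms.\<close>

lemma position_inj: assumes "position c = position d" shows "c = d"
proof (cases "c = 0 \<or> d = 0")
  case True
  then show ?thesis using assms position_pos[of c] position_pos[of d] by fastforce
next
  case False
  have eq: "numer c * 2 ^ expon d = numer d * 2 ^ expon c"
    using position_le_iff[of c d] position_le_iff[of d c] assms by simp
  have odd: "odd (numer c)" "odd (numer d)" using False by (auto simp: numer_def)
  \<comment> \<open>the exponent of 2 in an odd multiple of \<open>2 ^ j\<close> is \<open>j\<close>\<close>
  have aux: "i \<le> j" if "a * 2 ^ i = b * 2 ^ j" "odd b" for a b i j :: nat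
  proof (rule ccontr)
    assume "\<not> i \<le> j"
    then have i: "i = j + Suc (i - Suc j)" by simp
    have "a * 2 ^ Suc (i - Suc j) * 2 ^ j = b * 2 ^ j"
      using that(1) by (subst (asm) i) (simp add: power_add)
    then show False using that(2) by auto
  qed
  have e: "expon c = expon d" using aux[OF eq odd(2)] aux[OF eq[symmetric] odd(1)] by simp
  with eq have "numer c = numer d" by simp
  with e False have "pfst (c - 1) = pfst (d - 1)" "psnd (c - 1) = psnd (d - 1)"
    by (auto simp: numer_def expon_def)
  then have "c - 1 = d - 1" by (metis prod.collapse prod_decode_inverse)
  with False show ?thesis by arith
qed

lemma stage_bounds:
  assumes "c > 0" shows "real (stage c) < position c" "position c < real (stage c) + 1"
proof -
  let ?e = "2 ^ expon c :: nat"
  have n: "numer c = stage c * ?e + numer c mod ?e"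
    unfolding stage_def by (rule div_mult_mod_eq[symmetric])
  have "even ?e" "odd (numer c)" using assms by (auto simp: numer_def expon_def)
  then have "numer c mod ?e \<noteq> 0" by (metis dvd_trans mod_0_imp_dvd)
  then have "stage c * ?e < numer c" using n by linarith
  then have "real (stage c * ?e) < real (numer c)" by (simp only: of_nat_less_iff)
  then show "real (stage c) < position c" by (simp add: position_def field_simps)
  have "numer c mod ?e < ?e" by simp
  with n have "numer c < (stage c + 1) * ?e" unfolding distrib_right mult_1 by linarith
  then have "real (numer c) < real ((stage c + 1) * ?e)" by (simp only: of_nat_less_iff)
  then show "position c < real (stage c) + 1" by (simp add: position_def field_simps)
qed

lemma stage_eqI:
  assumes "c > 0" "real k \<le> position c" "position c \<le> real k + 1" shows "stage c = k"
  using stage_bounds[OF assms(1)] assms(2,3) by linarith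

text \<open>Choose \<open>m\<close> with \<open>(r - l) 2\<^sup>m > 2\<close>, and round \<open>l 2\<^sup>m\<close> up to an integer \<open>i\<close>: the point \<open>(i + 1/2) / 2\<^sup>m\<close> lies
  between \<open>l\<close> and \<open>r\<close>.\<close>

lemma position_dense:
  fixes l r :: real
  assumes "0 \<le> l" "l < r"
  obtains c where "c > 0" "l < position c" "position c < r"
proof -
  obtain m where m: "2 / (r - l) < 2 ^ m" using real_arch_pow[of 2] by force
  then have gt: "2 < r * 2 ^ m - l * 2 ^ m" using assms by (simp add: field_simps)
  define i where "i = nat \<lceil>l * 2 ^ m\<rceil>"
  have i: "l * 2 ^ m \<le> real i" "real i < l * 2 ^ m + 1"
    using assms(1) unfolding i_def by (simp_all add: of_nat_nat) linarith
  define c where "c = Suc (prod_encode (i, m))"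
  have "position c = (real i + 1 / 2) / 2 ^ m"
    by (simp add: c_def position_def numer_def expon_def field_simps)
  moreover have "l * 2 ^ m < real i + 1 / 2" "real i + 1 / 2 < r * 2 ^ m" using i gt by linarith+
  ultimately have "l < position c" "position c < r"
    by (simp_all add: pos_less_divide_eq pos_divide_less_eq)
  then show ?thesis using that[of c] by (simp add: c_def)
qed

section \<open>The order of a \<open>\<Sigma>\<^sup>0\<^sub>2\<close> matrix\<close>

text \<open>For the section \<open>h n k = f(n, x, k)\<close> of a matrix at \<open>x\<close>, the order is a sum over \<open>n\<close> of blocks. The block of
  \<open>n\<close> begins with a point \<open>\<langle>n, 0\<rangle>\<close> that is always there, followed by one copy of the rationals for every \<open>k\<close> with
  \<open>h n k \<noteq> 0\<close>, in increasing order of \<open>k\<close>. Tagging each point with the stage \<open>k\<close> on which it depends makes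
  membership of a point a single query to the matrix.\<close>

definition present :: "(nat \<Rightarrow> nat \<Rightarrow> nat) \<Rightarrow> nat \<Rightarrow> bool" where
  "present h a \<longleftrightarrow> psnd a = 0 \<or> h (pfst a) (stage (psnd a)) \<noteq> 0"

definition point_le :: "nat \<Rightarrow> nat \<Rightarrow> bool" where
  "point_le a b \<longleftrightarrow> pfst a < pfst b
     \<or> pfst a = pfst b \<and> numer (psnd a) * 2 ^ expon (psnd b) \<le> numer (psnd b) * 2 ^ expon (psnd a)"

definition block_order :: "(nat \<Rightarrow> nat \<Rightarrow> nat) \<Rightarrow> nat \<Rightarrow> nat" where
  "block_order h m =
     of_bool (present h (pfst m) \<and> present h (psnd m) \<and> point_le (pfst m) (psnd m))"

lemma point_le_iff:
  "point_le a b \<longleftrightarrow> pfst a < pfst b \<or> pfst a = pfst b \<and> position (psnd a) \<le> position (psnd b)"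
  by (simp add: point_le_def position_le_iff)

lemma point_eqI: assumes "pfst a = pfst b" "position (psnd a) = position (psnd b)" shows "a = b"
proof -
  have "prod_decode a = prod_decode b" using assms position_inj by (simp add: prod_eq_iff)
  then show ?thesis by (metis prod_decode_inverse)
qed

lemma order_rel_block_order:
  "order_rel (block_order h) = {(a, b). present h a \<and> present h b \<and> point_le a b}"
  by (auto simp: order_rel_def block_order_def)

lemma order_dom_block_order: "order_dom (block_order h) = Collect (present h)"
  by (auto simp: order_dom_def order_rel_block_order point_le_iff)

lemma block_order_linear: "codes_linear_order (block_order h)"
proof -
  have "linear_order_on (Collect (present h)) {(a, b). present h a \<and> present h b \<and> point_le a b}"
    unfolding linear_order_on_def partial_order_on_def preorder_on_def refl_on_def antisym_def
      trans_def total_on_def by (auto simp: point_le_iff intro: point_eqI)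
  then show ?thesis unfolding codes_linear_order_def order_dom_block_order order_rel_block_order
    by (simp add: block_order_def)
qed

text \<open>If the matrix vanishes in row \<open>n\<close>, the block of \<open>n\<close> is a single point, and the first point of the next block
  is its immediate successor.\<close>

lemma block_order_gap:
  assumes "\<forall>k. h n k = 0"
  shows "gap (block_order h) (prod_encode (n, 0)) (prod_encode (Suc n, 0))"
proof -
  have "point_le c (prod_encode (n, 0)) \<or> point_le (prod_encode (Suc n, 0)) c" if "present h c" for c
  proof -
    have "0 \<le> position (psnd c)" by (simp add: position_def)
    then show ?thesis using that assms unfolding present_def point_le_iff
      by (cases "pfst c" n rule: linorder_cases) auto
  qed
  then show ?thesis
    unfolding gap_def order_less_def order_dom_block_order order_rel_block_order
    by (auto simp: present_def point_le_iff prod_encode_eq)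
qed

text \<open>Suppose that the lower end \<open>a\<close> lies in a block with a nonzero entry. If \<open>a\<close> lies in a copy of the rationals,
  there are points of that copy immediately above it. If \<open>a\<close> is the first point of its block, then below the upper
  end \<open>b\<close> there is an initial piece of a copy: of the one that contains \<open>b\<close>, or of any copy in the block if \<open>b\<close>
  lies in a later one. In all cases some point lies strictly between \<open>a\<close> and \<open>b\<close>.\<close>

lemma gap_block_order:
  assumes gap: "gap (block_order h) a b"
  shows "h (pfst a) k = 0"
proof (rule ccontr)
  let ?n = "pfst a"
  assume k: "h ?n k \<noteq> 0"
  from gap have a: "present h a" and b: "present h b" and ab: "point_le a b" "a \<noteq> b"
    and no: "\<And>c. present h c \<Longrightarrow> point_le c a \<or> point_le b c"
    unfolding gap_def order_less_def order_dom_block_order order_rel_block_order by auto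
  let ?A = "position (psnd a)" and ?B = "position (psnd b)"
  have A: "0 \<le> ?A" by (simp add: position_def)
  have block: "?n < pfst b \<or> ?n = pfst b \<and> ?A < ?B"
    using ab point_eqI[of a b] unfolding point_le_iff by fastforce
  \<comment> \<open>an interval inside a present stage \<open>j\<close>, above \<open>a\<close> and, where \<open>b\<close> lies in the same block, below \<open>b\<close>\<close>
  have "\<exists>j l r. h ?n j \<noteq> 0 \<and> real j \<le> l \<and> l < r \<and> r \<le> real j + 1 \<and> ?A \<le> l
      \<and> (?n = pfst b \<longrightarrow> r \<le> ?B)"
  proof (cases "psnd a = 0")
    case False
    then have "h ?n (stage (psnd a)) \<noteq> 0" using a by (simp add: present_def)
    moreover note stage_bounds[of "psnd a"]
    ultimately show ?thesis using False block
      by (intro exI[of _ "stage (psnd a)"] exI[of _ ?A]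
          exI[of _ "if ?n = pfst b then min ?B (real (stage (psnd a)) + 1) else real (stage (psnd a)) + 1"])
        auto
  next
    case a0: True
    show ?thesis
    proof (cases "?n = pfst b")
      case True
      with block a0 have "psnd b > 0" by (cases "psnd b") auto
      with b True have "h ?n (stage (psnd b)) \<noteq> 0" by (simp add: present_def)
      then show ?thesis using stage_bounds[OF \<open>psnd b > 0\<close>] a0
        by (intro exI[of _ "stage (psnd b)"] exI[of _ "real (stage (psnd b))"] exI[of _ ?B]) auto
    next
      case False
      then show ?thesis using k a0
        by (intro exI[of _ k] exI[of _ "real k"] exI[of _ "real k + 1"]) auto
    qed
  qed
  then obtain j l r where j: "h ?n j \<noteq> 0" "real j \<le> l" "l < r" "r \<le> real j + 1" "?A \<le> l"
    "?n = pfst b \<Longrightarrow> r \<le> ?B" by blast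
  obtain c where c: "c > 0" "l < position c" "position c < r"
    using position_dense[OF order_trans[OF A j(5)] j(3)] by blast
  have "stage c = j" using c j by (intro stage_eqI) auto
  then have "present h (prod_encode (?n, c))" using j(1) by (simp add: present_def)
  from no[OF this] have "position c \<le> ?A \<or> pfst b < ?n \<or> pfst b = ?n \<and> ?B \<le> position c"
    unfolding point_le_iff by simp
  then show False
  proof (elim disjE conjE)
    assume "position c \<le> ?A" then show False using c j(5) by linarith
  next
    assume "pfst b < ?n" then show False using block by linarith
  next
    assume "pfst b = ?n" "?B \<le> position c" then show False using c j(6) by simp
  qed
qed

section \<open>Completeness of \<open>NonDense\<close>\<close>

lemma NonDense_eq_Some:
  "NonDense C z = Some x \<longleftrightarrow>
     (\<exists>a b. prod_space C (natsp C) (prod_space C (natsp C) (baire C)) z = Some (a, b, x)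
        \<and> codes_linear_order x \<and> gap x a b)"
  by (auto simp: NonDense_def gap_not_dense split: option.splits prod.splits if_splits)

lemma computable_numer [computable_intros]: "computable f \<Longrightarrow> computable (\<lambda>z. numer (f z))"
  unfolding numer_def by (intro computable_intros)

lemma computable_expon [computable_intros]: "computable f \<Longrightarrow> computable (\<lambda>z. expon (f z))"
  unfolding expon_def by (intro computable_intros)

lemma computable_stage [computable_intros]: "computable f \<Longrightarrow> computable (\<lambda>z. stage (f z))"
  unfolding stage_def by (intro computable_intros)

lemma decidable_point_le [computable_intros]:
  "computable f \<Longrightarrow> computable g \<Longrightarrow> decidable (\<lambda>z. point_le (f z) (g z))"
  unfolding point_le_def by (intro computable_intros)

context effective_coding
begin

abbreviation nondense_space :: "('c, nat \<times> nat \<times> (nat \<Rightarrow> nat)) rep_space" where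
  "nondense_space \<equiv> prod_space C (natsp C) (prod_space C (natsp C) (baire C))"

lemma decides_gap_test:
  assumes n: "morphism C X (natsp C) n" and x: "morphism C X (baire C) x"
    and c: "morphism C X (natsp C) c" and d: "morphism C X (natsp C) d" and e: "morphism C X (natsp C) e"
  shows "decides X (\<lambda>z. gap_test (n z) (x z) (c z) (d z) (e z))"
proof -
  have R: "decides X (\<lambda>z. x z (prod_encode (u z, v z)) = 1)"
    if "morphism C X (natsp C) u" "morphism C X (natsp C) v" for u v
    by (rule decides1[where P="\<lambda>i. i = 1"])
      (intro computable_intros, intro morphism_value[OF x] morphism_nat_pair that)
  have le: "decides X (\<lambda>z. x z (c z) \<le> 1)"
    by (rule decides1[where P="\<lambda>i. i \<le> 1"]) (intro computable_intros, intro morphism_value[OF x] c)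
  have eq: "decides X (\<lambda>z. u z = v z)"
    if "morphism C X (natsp C) u" "morphism C X (natsp C) v" for u v
    by (rule decides2[where P="(=)"]) (intro computable_intros, intro that, intro that)
  have a: "morphism C X (natsp C) (\<lambda>z. pfst (n z))" and b: "morphism C X (natsp C) (\<lambda>z. psnd (n z))"
    by (rule morphism_nat1[OF _ n], intro computable_intros)+
  show ?thesis unfolding gap_test_def Let_def
    by (intro decides_conj decides_imp decides_disj decides_not R eq le a b c d e)
qed

text \<open>The witness is the pair of ends of the gap, so names on both sides differ only in how they group the two
  ends and \<open>x\<close>.\<close>

lemma Sigma02_NonDense: "Sigma02 C (NonDense C)"
proof -
  define f where "f = (\<lambda>(n, x, k). of_bool (\<not> gap_test n x (pfst k) (pfst (psnd k)) (psnd (psnd k))) :: nat)"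
  have k: "morphism C matrix_space (natsp C) (\<lambda>z. snd (snd z))"
    by (rule morphism_snd morphism_id)+
  have "decides matrix_space (\<lambda>z. \<not> gap_test (fst z) (fst (snd z))
      (pfst (snd (snd z))) (pfst (psnd (snd (snd z)))) (psnd (psnd (snd (snd z)))))"
    by (intro decides_not decides_gap_test)
      (rule morphism_fst morphism_snd morphism_id
        morphism_nat1[OF _ k, of pfst] morphism_nat1[OF _ k, of "\<lambda>i. pfst (psnd i)"]
        morphism_nat1[OF _ k, of "\<lambda>i. psnd (psnd i)"] computable_intros)+
  then have f: "morphism C matrix_space (natsp C) f"
    unfolding f_def case_prod_unfold .
  have f_iff: "(\<forall>k. f (n, x, k) = 0) \<longleftrightarrow> codes_linear_order x \<and> gap x (pfst n) (psnd n)" for n x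
  proof -
    have "(\<forall>k. f (n, x, k) = 0) \<longleftrightarrow> (\<forall>c d e. gap_test n x c d e)"
      unfolding f_def by simp (metis fst_conv snd_conv prod_encode_inverse)
    then show ?thesis using gap_test_iff by simp
  qed
  have "morphism C nondense_space (prod_space C (natsp C) (baire C))
      (\<lambda>z. (prod_encode (fst z, fst (snd z)), snd (snd z)))"
    by (rule morphism_pair morphism_nat_pair morphism_fst morphism_snd morphism_id)+
  then obtain r where r: "r \<in> realizable C" "\<And>p z. nondense_space p = Some z \<Longrightarrow>
      \<exists>q. r p = Some q \<and> prod_space C (natsp C) (baire C) q
        = Some (prod_encode (fst z, fst (snd z)), snd (snd z))"
    by (elim morphismE) blast
  have "sub_le C (NonDense C) (Pi01_union f)"
    by (rule sub_leI[OF r(1)]) (fastforce simp: NonDense_eq_Some Pi01_union_eq_Some f_iff dest: r(2))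
  moreover
  have "morphism C (prod_space C (natsp C) (baire C)) nondense_space
      (\<lambda>z. (pfst (fst z), psnd (fst z), snd z))"
    by (rule morphism_pair morphism_nat1[where F=pfst] morphism_nat1[where F=psnd]
        morphism_fst morphism_snd morphism_id computable_intros)+
  then obtain s where s: "s \<in> realizable C" "\<And>p z. prod_space C (natsp C) (baire C) p = Some z \<Longrightarrow>
      \<exists>q. s p = Some q \<and> nondense_space q = Some (pfst (fst z), psnd (fst z), snd z)"
    by (elim morphismE) blast
  have "sub_le C (Pi01_union f) (NonDense C)"
    by (rule sub_leI[OF s(1)]) (fastforce simp: NonDense_eq_Some Pi01_union_eq_Some f_iff dest: s(2))
  moreover
  have "morphism C nondense_space (baire C) (\<lambda>z. snd (snd z))"
    by (rule morphism_snd morphism_id)+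
  then obtain t where t: "t \<in> realizable C" "\<And>p z. nondense_space p = Some z \<Longrightarrow>
      \<exists>q. t p = Some q \<and> baire C q = Some (snd (snd z))"
    by (elim morphismE) blast
  have "\<forall>p x. NonDense C p = Some x \<longrightarrow> (\<exists>q. t p = Some q \<and> baire C q = Some x)"
    by (fastforce simp: NonDense_eq_Some dest: t(2))
  then have "subobject C (NonDense C) (baire C)"
    unfolding subobject_def ran_def using t(1) by blast
  ultimately show ?thesis unfolding Sigma02_iff sub_equiv_def using f by blast
qed

text \<open>By currying it suffices to compute the order relation at a single pair from \<open>x\<close>, which takes one query to
  the matrix for each of the two points.\<close>

lemma morphism_block_order:
  assumes f: "morphism C matrix_space (natsp C) f"
  shows "morphism C (baire C) (baire C) (\<lambda>x. block_order (\<lambda>n k. f (n, x, k)))"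
proof (rule morphism_curry)
  let ?X = "prod_space C (baire C) (natsp C)"
  have x: "morphism C ?X (baire C) fst" and m: "morphism C ?X (natsp C) snd"
    by (rule morphism_fst_prod morphism_snd_prod)+
  have present: "decides ?X (\<lambda>z. present (\<lambda>n k. f (n, fst z, k)) (F (snd z)))"
    if F: "computable F" for F
  proof -
    have 1: "morphism C ?X (natsp C) (\<lambda>z. pfst (F (snd z)))"
      by (rule morphism_nat1[OF _ m, where F="\<lambda>i. pfst (F i)"]) (intro computable_intros F)
    have 2: "morphism C ?X (natsp C) (\<lambda>z. stage (psnd (F (snd z))))"
      by (rule morphism_nat1[OF _ m, where F="\<lambda>i. stage (psnd (F i))"]) (intro computable_intros F)
    have 3: "decides ?X (\<lambda>z. psnd (F (snd z)) = 0)"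
      by (rule decides1[OF _ m, where P="\<lambda>i. psnd (F i) = 0"]) (intro computable_intros F)
    have 4: "decides ?X (\<lambda>z. f (pfst (F (snd z)), fst z, stage (psnd (F (snd z)))) \<noteq> 0)"
      by (rule decides1[where P="\<lambda>i. i \<noteq> 0"], intro computable_intros)
        (rule morphism_comp[OF f morphism_pair[OF 1 morphism_pair[OF x 2]]])
    show ?thesis unfolding present_def by (rule decides_disj[OF 3 4])
  qed
  have le: "decides ?X (\<lambda>z. point_le (pfst (snd z)) (psnd (snd z)))"
    by (rule decides1[OF _ m, where P="\<lambda>i. point_le (pfst i) (psnd i)"]) (intro computable_intros)
  show "morphism C ?X (natsp C) (\<lambda>z. block_order (\<lambda>n k. f (n, fst z, k)) (snd z))"
    unfolding block_order_def
    by (intro decides_conj present[of pfst] present[of psnd] le computable_pfst computable_psnd computable_id)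
qed

text \<open>A witness \<open>n\<close> gives the gap between the first points of the blocks of \<open>n\<close> and \<open>Suc n\<close>; conversely the
  block of the lower end of any gap is a witness.\<close>

lemma Pi01_union_reducible:
  assumes f: "morphism C matrix_space (natsp C) f"
  shows "many_one_reducible C (baire C) (Pi01_union f) (baire C) (NonDense C)"
proof -
  let ?\<phi> = "\<lambda>x. block_order (\<lambda>n k. f (n, x, k))"
  let ?Z = "prod_space C (natsp C) (baire C)"
  have \<phi>: "morphism C (baire C) (baire C) ?\<phi>" by (rule morphism_block_order[OF f])
  have "morphism C ?Z nondense_space
      (\<lambda>z. (prod_encode (fst z, 0), prod_encode (Suc (fst z), 0), ?\<phi> (snd z)))"
    by (rule morphism_pair morphism_nat1[where F="\<lambda>n. prod_encode (Suc n, 0)"]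
        morphism_nat1[where F="\<lambda>n. prod_encode (n, 0)"] morphism_comp[OF \<phi>]
        morphism_fst morphism_snd morphism_id computable_intros)+
  then obtain r where r: "r \<in> realizable C" "\<And>p z. ?Z p = Some z \<Longrightarrow> \<exists>q. r p = Some q
      \<and> nondense_space q = Some (prod_encode (fst z, 0), prod_encode (Suc (fst z), 0), ?\<phi> (snd z))"
    by (elim morphismE) blast
  have gap_name: "\<exists>q. r p = Some q \<and> NonDense C q = Some (?\<phi> x)" if "Pi01_union f p = Some x" for p x
    using that r(2) block_order_gap[of "\<lambda>n k. f (n, x, k)"] block_order_linear
    by (fastforce simp: Pi01_union_eq_Some NonDense_eq_Some)
  have "morphism C (prod_space C (baire C) nondense_space) ?Z (\<lambda>z. (pfst (fst (snd z)), fst z))"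
    by (rule morphism_pair morphism_nat1[where F=pfst] morphism_fst morphism_snd morphism_id
        computable_intros)+
  then obtain s where s: "s \<in> realizable C" "\<And>p z. prod_space C (baire C) nondense_space p = Some z \<Longrightarrow>
      \<exists>q. s p = Some q \<and> ?Z q = Some (pfst (fst (snd z)), fst z)"
    by (elim morphismE) blast
  have index_name: "\<exists>t. s (tup C (p, q)) = Some t \<and> Pi01_union f t = Some x"
    if pq: "baire C p = Some x" "NonDense C q = Some (?\<phi> x)" for p q x
  proof -
    obtain a b where ab: "nondense_space q = Some (a, b, ?\<phi> x)" "gap (?\<phi> x) a b"
      using pq(2) unfolding NonDense_eq_Some by blast
    have "prod_space C (baire C) nondense_space (tup C (p, q)) = Some (x, a, b, ?\<phi> x)"
      using pq(1) ab(1) by (simp add: prod_space_eq_Some untup_tup)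
    from s(2)[OF this] gap_block_order[OF ab(2)] show ?thesis by (auto simp: Pi01_union_eq_Some)
  qed
  have "x \<in> ran (Pi01_union f) \<longleftrightarrow> ?\<phi> x \<in> ran (NonDense C)" if "x \<in> ran (baire C)" for x
    using that gap_name index_name unfolding ran_def by blast
  then show ?thesis
    unfolding many_one_reducible_def using \<phi> r(1) s(1) gap_name index_name by blast
qed

theorem NonDense_complete: "Sigma02_complete C (NonDense C)"
  unfolding Sigma02_complete_def
proof (intro conjI allI impI)
  fix A assume "Sigma02 C A"
  then obtain f where "morphism C matrix_space (natsp C) f" "sub_equiv C A (Pi01_union f)"
    unfolding Sigma02_iff by blast
  then show "many_one_reducible C (baire C) A (baire C) (NonDense C)"
    using many_one_reducible_cong Pi01_union_reducible by blast
qed (rule Sigma02_NonDense)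

end

theorem proposition5p37:
  shows "Sigma02_complete K1 (NonDense K1)
       \<and> Sigma02_complete K2 (NonDense K2)
       \<and> Sigma02_complete KV (NonDense KV)"
  unfolding K2_eq KV_eq
  by (intro conjI effective_coding.NonDense_complete effective_coding_K1 effective_coding_kleene) auto

end
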